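(* Let $(S^x_n)$ be the singular reflected quadrant walk with data $(p,h,v,q)$ (as defined in the context), and for $(i,j)\in\mathbb N_0^2$ and $|z|\le 1$ let $F(i,j,z)=\sum_{n\ge 0}\mathbf P(Z_{(i,j)}=n)z^n$ be the generating function of its number of boundary contacts $Z_{(i,j)}$. Let $$G(i,j,z)=\sum_{m\in\mathbb Z}\bigl(c_m(z)\alpha_m^i\beta_m^j+d_{m+1}(z)\alpha_{m+1}^i\beta_m^j\bigr),$$ with $(\alpha_m,\beta_m)_{m\in\mathbb Z}$ and $c_m(z),d_m(z)$ as defined in the context. Then for every $(i,j)\in\mathbb N_0^2\setminus\{(0,0)\}$, $F(i,j,z)=G(i,j,z)$.
   Context: $\mathbb N=\{1,2,\dots\}$, $\mathbb N_0=\{0,1,2,\dots\}$. **Singular reflected quadrant walk with data $(p,h,v,q)$.** Let $\{p_{k,\ell}\},\{h_{k,\ell}\},\{v_{k,\ell}\},\{q_{k,\ell}\}$, indexed by $(k,\ell)\in\mathbb Z^2$, be non-negative weights such that: (1) each family sums to $1$; (2) $p_{k,\ell}=0$ whenever $k\le -2$ or $\ell\le -2$; (3) $p_{-1,-1}=p_{-1,0}=p_{0,-1}=0$; (4) $p_{-1,1}\,p_{1,-1}\ne 0$; (5) $p_{k,\ell}>0$ for some $(k,\ell)$ with $k+\ell>0$; (6) $\sum_{k,\ell}p_{k,\ell}e^{kx+\ell y}$ is finite in a neighborhood of every point of the curve $\mathcal L=\{(x,y)\in\mathbb R^2:\sum_{k,\ell}p_{k,\ell}e^{kx+\ell y}=1\}$;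 (7) $h_{k,\ell}=v_{k,\ell}=q_{k,\ell}=0$ whenever $k<0$ or $\ell<0$ or $(k,\ell)=(0,0)$; (8) $0<\sum\ell h_{k,\ell}<\infty$, $\sum k h_{k,\ell}<\infty$; $0<\sum k v_{k,\ell}<\infty$, $\sum\ell v_{k,\ell}<\infty$; $0<\sum k q_{k,\ell}<\infty$, $0<\sum\ell q_{k,\ell}<\infty$; (9) positive interior drift: $\sum k p_{k,\ell}>0$ and $\sum\ell p_{k,\ell}>0$. For $x\in\mathbb N_0^2$, $(S_n^x)_{n\ge0}$ is the Markov chain on $\mathbb N_0^2$ with $S_0^x=x$ whose increments are independent and distributed according to $p$ at points of $\mathbb N^2$, according to $h$ at points of $\mathbb N\times\{0\}$, according to $v$ at points of $\{0\}\times\mathbb N$, and according to $q$ at $(0,0)$. The number of boundary contacts is $Z_x=\sum_{n\ge0}\mathbf 1_{\{S_n^x\in\mathbb N_0^2\setminus\mathbb N^2\}}$. **The sequence $(\alpha_m,\beta_m)$.** Let $K(\alpha,\beta)=\sum_{k,\ell\ge -1}p_{k,\ell}\alpha^{k+1}\beta^{\ell+1}-\alpha\beta$. For $\alpha\in(0,1)$ let $u(\alpha)$ be the unique $\beta>\alpha$ with $K(\alpha,\beta)=0$; for $\beta\in(0,1)$ let $v(\beta)$ be the unique $\alpha>\beta$ with $K(\alpha,\beta)=0$; put $u(0)=v(0)=0$, $u(1)=v(1)=1$ (the function $v(\cdot)$ is not to be confused with the weights $v_{k,\ell}$). It is known that $u$ has a unique maximizer $\widehat\alpha\in(0,1)$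 on $[0,1]$, with $\widehat\beta:=u(\widehat\alpha)>1$, and is strictly increasing on $[0,\widehat\alpha]$; likewise $v$ has a unique maximizer $\widetilde\beta\in(0,1)$, with $\widetilde\alpha:=v(\widetilde\beta)>1$, and is strictly increasing on $[0,\widetilde\beta]$. Let $u^*:[0,\widehat\beta]\to[0,\widehat\alpha]$ and $v^*:[0,\widetilde\alpha]\to[0,\widetilde\beta]$ be the inverses of these restrictions. Then $\alpha_0=\beta_0=1$; for $m\ge1$, $\alpha_m=u^*(\beta_{m-1})$, $\beta_m=v^*(\alpha_m)$; for $m\le -1$, $\beta_m=v^*(\alpha_{m+1})$, $\alpha_m=u^*(\beta_m)$. **The coefficients.** The rational functions $c_m,d_m$ ($m\in\mathbb Z$) are determined by $c_0(z)=1$ and, for all $m\in\mathbb Z$, $$d_{m+1}(z)=-c_m(z)\frac{1-z\sum_{k,\ell}v_{k,\ell}\alpha_m^k\beta_m^\ell}{1-z\sum_{k,\ell}v_{k,\ell}\alpha_{m+1}^k\beta_m^\ell},\qquad c_m(z)=-d_m(z)\frac{1-z\sum_{k,\ell}h_{k,\ell}\alpha_m^k\beta_{m-1}^\ell}{1-z\sum_{k,\ell}h_{k,\ell}\alpha_m^k\beta_m^\ell}$$ (used forwards for positive indices and solved backwards from $c_0=1$ for $d_0,c_{-1},d_{-1},\dots$). *)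

theory Defs
  imports "HOL-Probability.Probability"
begin

type_synonym weights = "(int \<times> int) pmf"

definition laplace_term :: "weights \<Rightarrow> real \<Rightarrow> real \<Rightarrow> int \<times> int \<Rightarrow> real" where
  "laplace_term p x y = (\<lambda>(k, l). pmf p (k, l) * exp (of_int k * x + of_int l * y))"

text \<open>
  A divergent \<^const>\<open>infsum\<close> is 0, hence a strict lower bound 0 on an
  \<^const>\<open>infsum\<close> includes convergence, and the set of points where the Laplace transform
  equals 1 contains no point of divergence.
\<close>

locale singular_quadrant_data =
  fixes p h v q :: weights
  assumes p_support: "\<And>k l. k \<le> -2 \<or> l \<le> -2 \<Longrightarrow> pmf p (k, l) = 0"
    and p_singular: "pmf p (-1, -1) = 0" "pmf p (-1, 0) = 0" "pmf p (0, -1) = 0"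
    and p_corners: "pmf p (-1, 1) * pmf p (1, -1) \<noteq> 0"
    and p_outward: "\<exists>k l. k + l > 0 \<and> pmf p (k, l) > 0"
    and p_laplace: "\<And>x y. (\<Sum>\<^sub>\<infinity>kl. laplace_term p x y kl) = 1 \<Longrightarrow>
          (\<forall>\<^sub>F w in nhds (x, y). laplace_term p (fst w) (snd w) summable_on UNIV)"
    and reflection_support:
      "\<And>w k l. w \<in> {h, v, q} \<Longrightarrow> k < 0 \<or> l < 0 \<or> (k, l) = (0, 0) \<Longrightarrow> pmf w (k, l) = 0"
    and h_means: "(\<Sum>\<^sub>\<infinity>(k, l). of_int l * pmf h (k, l)) > (0::real)"
      "(\<lambda>(k, l). of_int k * pmf h (k, l)) summable_on UNIV"
    and v_means: "(\<Sum>\<^sub>\<infinity>(k, l). of_int k * pmf v (k, l)) > (0::real)"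
      "(\<lambda>(k, l). of_int l * pmf v (k, l)) summable_on UNIV"
    and q_means: "(\<Sum>\<^sub>\<infinity>(k, l). of_int k * pmf q (k, l)) > (0::real)"
      "(\<Sum>\<^sub>\<infinity>(k, l). of_int l * pmf q (k, l)) > (0::real)"
    and p_drift: "(\<Sum>\<^sub>\<infinity>(k, l). of_int k * pmf p (k, l)) > (0::real)"
      "(\<Sum>\<^sub>\<infinity>(k, l). of_int l * pmf p (k, l)) > (0::real)"

definition step_law :: "weights \<Rightarrow> weights \<Rightarrow> weights \<Rightarrow> weights \<Rightarrow> nat \<times> nat \<Rightarrow> weights" where
  "step_law p h v q = (\<lambda>(i, j).
     if i > 0 \<and> j > 0 then p else if i > 0 then h else if j > 0 then v else q)"

definition transition_prob ::
    "weights \<Rightarrow> weights \<Rightarrow> weights \<Rightarrow> weights \<Rightarrow> nat \<times> nat \<Rightarrow> nat \<times> nat \<Rightarrow> real" where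
  "transition_prob p h v q s t =
     pmf (step_law p h v q s) (int (fst t) - int (fst s), int (snd t) - int (snd s))"

text \<open>
  The Markov property in multiplied form, so that histories of probability 0 need no
  separate treatment.
\<close>

definition reflected_walk ::
    "weights \<Rightarrow> weights \<Rightarrow> weights \<Rightarrow> weights \<Rightarrow> 'a measure \<Rightarrow> nat \<times> nat \<Rightarrow>
     (nat \<Rightarrow> 'a \<Rightarrow> nat \<times> nat) \<Rightarrow> bool" where
  "reflected_walk p h v q M x S \<longleftrightarrow>
     prob_space M \<and>
     (\<forall>n. S n \<in> measurable M (count_space UNIV)) \<and>
     (AE \<omega> in M. S 0 \<omega> = x) \<and>
     (\<forall>n s. measure M {\<omega> \<in> space M. \<forall>k\<le>Suc n. S k \<omega> = s k} =
            measure M {\<omega> \<in> space M. \<forall>k\<le>n. S k \<omega> = s k} * transition_prob p h v q (s n) (s (Suc n)))"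

definition boundary_contacts :: "(nat \<Rightarrow> 'a \<Rightarrow> nat \<times> nat) \<Rightarrow> 'a \<Rightarrow> ennreal" where
  "boundary_contacts S \<omega> = (\<Sum>n. indicator {s. fst s = 0 \<or> snd s = 0} (S n \<omega>))"

definition contact_gf :: "'a measure \<Rightarrow> (nat \<Rightarrow> 'a \<Rightarrow> nat \<times> nat) \<Rightarrow> complex \<Rightarrow> complex" where
  "contact_gf M S z =
     (\<Sum>n. of_real (measure M {\<omega> \<in> space M. boundary_contacts S \<omega> = of_nat n}) * z ^ n)"

text \<open>
  For \<open>\<alpha>, \<beta> > 0\<close> a divergent series makes \<open>kernel p \<alpha> \<beta>\<close> equal to
  \<open>- \<alpha> * \<beta>\<close>, so divergence creates no zeros.
\<close>

definition kernel :: "weights \<Rightarrow> real \<Rightarrow> real \<Rightarrow> real" where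
  "kernel p \<alpha> \<beta> =
     (\<Sum>\<^sub>\<infinity>(k, l)\<in>{-1..} \<times> {-1..}. pmf p (k, l) * \<alpha> powi (k + 1) * \<beta> powi (l + 1)) - \<alpha> * \<beta>"

text \<open>
  The functions \<open>u\<close> and \<open>v\<close> of the kernel curve. The value 0 in the last branch only serves
  to make them total; it lies below every genuine value on the open unit interval.
\<close>

definition u_fun :: "weights \<Rightarrow> real \<Rightarrow> real" where
  "u_fun p \<alpha> =
     (if \<alpha> = 0 then 0 else if \<alpha> = 1 then 1
      else if \<exists>!\<beta>. \<beta> > \<alpha> \<and> kernel p \<alpha> \<beta> = 0 then THE \<beta>. \<beta> > \<alpha> \<and> kernel p \<alpha> \<beta> = 0
      else 0)"

definition v_fun :: "weights \<Rightarrow> real \<Rightarrow> real" where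
  "v_fun p \<beta> =
     (if \<beta> = 0 then 0 else if \<beta> = 1 then 1
      else if \<exists>!\<alpha>. \<alpha> > \<beta> \<and> kernel p \<alpha> \<beta> = 0 then THE \<alpha>. \<alpha> > \<beta> \<and> kernel p \<alpha> \<beta> = 0
      else 0)"

definition alpha_hat :: "weights \<Rightarrow> real" where
  "alpha_hat p = arg_max_on (u_fun p) {0..1}"

definition beta_tilde :: "weights \<Rightarrow> real" where
  "beta_tilde p = arg_max_on (v_fun p) {0..1}"

definition u_star :: "weights \<Rightarrow> real \<Rightarrow> real" where
  "u_star p = the_inv_into {0..alpha_hat p} (u_fun p)"

definition v_star :: "weights \<Rightarrow> real \<Rightarrow> real" where
  "v_star p = the_inv_into {0..beta_tilde p} (v_fun p)"

text \<open>
  \<open>ab_fwd p n\<close> is \<open>(\<alpha>\<^sub>n, \<beta>\<^sub>n)\<close> and \<open>ab_bwd p n\<close> is \<open>(\<alpha>\<^sub>-\<^sub>n, \<beta>\<^sub>-\<^sub>n)\<close>.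
\<close>

primrec ab_fwd :: "weights \<Rightarrow> nat \<Rightarrow> real \<times> real" where
  "ab_fwd p 0 = (1, 1)"
| "ab_fwd p (Suc n) = (let a = u_star p (snd (ab_fwd p n)) in (a, v_star p a))"

primrec ab_bwd :: "weights \<Rightarrow> nat \<Rightarrow> real \<times> real" where
  "ab_bwd p 0 = (1, 1)"
| "ab_bwd p (Suc n) = (let b = v_star p (fst (ab_bwd p n)) in (u_star p b, b))"

definition alpha :: "weights \<Rightarrow> int \<Rightarrow> real" where
  "alpha p m = (if m \<ge> 0 then fst (ab_fwd p (nat m)) else fst (ab_bwd p (nat (-m))))"

definition beta :: "weights \<Rightarrow> int \<Rightarrow> real" where
  "beta p m = (if m \<ge> 0 then snd (ab_fwd p (nat m)) else snd (ab_bwd p (nat (-m))))"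

lemma alpha_beta_0: "alpha p 0 = 1" "beta p 0 = 1"
  by (simp_all add: alpha_def beta_def)

lemma alpha_beta_pos:
  assumes "m \<ge> 1"
  shows "alpha p m = u_star p (beta p (m - 1))" "beta p m = v_star p (alpha p m)"
proof -
  obtain n where m: "m = int (Suc n)"
    using assms by (metis Suc_pred' nat_0_le zero_less_nat_eq zero_less_one order_less_le_trans order_less_imp_le)
  show "alpha p m = u_star p (beta p (m - 1))" "beta p m = v_star p (alpha p m)"
    by (simp_all add: m alpha_def beta_def Let_def nat_add_distrib)
qed

lemma alpha_beta_neg:
  assumes "m \<le> -1"
  shows "beta p m = v_star p (alpha p (m + 1))" "alpha p m = u_star p (beta p m)"
proof -
  obtain n where m: "m = - int (Suc n)"
    using assms by (metis Suc_pred' add.inverse_inverse minus_le_iff nat_0_le zero_less_nat_eq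
        zero_less_one order_less_le_trans order_less_imp_le)
  show "beta p m = v_star p (alpha p (m + 1))" "alpha p m = u_star p (beta p m)"
    by (cases n; simp add: m alpha_def beta_def Let_def nat_add_distrib)+
qed

definition weight_gf :: "weights \<Rightarrow> real \<Rightarrow> real \<Rightarrow> real" where
  "weight_gf w \<alpha> \<beta> = (\<Sum>\<^sub>\<infinity>(k, l). pmf w (k, l) * \<alpha> powi k * \<beta> powi l)"

text \<open>\<open>factor p w z m n\<close> is \<open>1 - z * (\<Sum>k l. w\<^sub>k\<^sub>l * \<alpha>\<^sub>m\<^sup>k * \<beta>\<^sub>n\<^sup>l)\<close>.\<close>

definition factor :: "weights \<Rightarrow> weights \<Rightarrow> complex \<Rightarrow> int \<Rightarrow> int \<Rightarrow> complex" where
  "factor p w z m n = 1 - z * of_real (weight_gf w (alpha p m) (beta p n))"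

text \<open>
  The two recurrences between the rational functions \<open>c\<^sub>m\<close> and \<open>d\<^sub>m\<close>, run
  forwards from \<open>c\<^sub>0 = 1\<close> for positive indices and solved for the unknown coefficient for the
  others. In the solved form the denominators do not vanish on the closed unit disc, whereas
  \<open>factor p h z 0 0\<close>, a denominator of the unsolved second recurrence, is zero at \<open>z = 1\<close>.
  \<open>c_fwd p h v z n\<close> is \<open>c\<^sub>n(z)\<close> and \<open>c_bwd p h v z n\<close> is \<open>c\<^sub>-\<^sub>n(z)\<close>.
\<close>

primrec c_fwd :: "weights \<Rightarrow> weights \<Rightarrow> weights \<Rightarrow> complex \<Rightarrow> nat \<Rightarrow> complex" where
  "c_fwd p h v z 0 = 1"
| "c_fwd p h v z (Suc n) =
     (let m = int n;
          d = - c_fwd p h v z n * (factor p v z m m / factor p v z (m + 1) m)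
      in - d * (factor p h z (m + 1) m / factor p h z (m + 1) (m + 1)))"

primrec c_bwd :: "weights \<Rightarrow> weights \<Rightarrow> weights \<Rightarrow> complex \<Rightarrow> nat \<Rightarrow> complex" where
  "c_bwd p h v z 0 = 1"
| "c_bwd p h v z (Suc n) =
     (let m = - int n;
          d = - c_bwd p h v z n * (factor p h z m m / factor p h z m (m - 1))
      in - d * (factor p v z m (m - 1) / factor p v z (m - 1) (m - 1)))"

definition c_coeff :: "weights \<Rightarrow> weights \<Rightarrow> weights \<Rightarrow> complex \<Rightarrow> int \<Rightarrow> complex" where
  "c_coeff p h v z m = (if m \<ge> 0 then c_fwd p h v z (nat m) else c_bwd p h v z (nat (-m)))"

definition d_coeff :: "weights \<Rightarrow> weights \<Rightarrow> weights \<Rightarrow> complex \<Rightarrow> int \<Rightarrow> complex" where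
  "d_coeff p h v z m =
     (if m \<ge> 1
      then - c_coeff p h v z (m - 1) * (factor p v z (m - 1) (m - 1) / factor p v z m (m - 1))
      else - c_coeff p h v z m * (factor p h z m m / factor p h z m (m - 1)))"

lemma c_coeff_0: "c_coeff p h v z 0 = 1"
  by (simp add: c_coeff_def)

lemma c_coeff_pos:
  assumes "m \<ge> 1"
  shows "c_coeff p h v z m = - d_coeff p h v z m * (factor p h z m (m - 1) / factor p h z m m)"
proof -
  obtain n where m: "m = int (Suc n)"
    using assms by (metis Suc_pred' nat_0_le zero_less_nat_eq zero_less_one order_less_le_trans order_less_imp_le)
  show ?thesis
    by (simp add: m c_coeff_def d_coeff_def Let_def nat_add_distrib add.commute)
qed

lemma c_coeff_neg:
  assumes "m \<le> -1"
  shows "c_coeff p h v z m =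
           - d_coeff p h v z (m + 1) * (factor p v z (m + 1) m / factor p v z m m)"
proof -
  obtain n where m: "m = - int (Suc n)"
    using assms by (metis Suc_pred' add.inverse_inverse minus_le_iff nat_0_le zero_less_nat_eq
        zero_less_one order_less_le_trans order_less_imp_le)
  show ?thesis
    by (cases n; simp add: m c_coeff_def d_coeff_def Let_def nat_add_distrib add.commute)
qed

definition G_term ::
    "weights \<Rightarrow> weights \<Rightarrow> weights \<Rightarrow> nat \<Rightarrow> nat \<Rightarrow> complex \<Rightarrow> int \<Rightarrow> complex" where
  "G_term p h v i j z m =
     c_coeff p h v z m * of_real (alpha p m ^ i * beta p m ^ j)
     + d_coeff p h v z (m + 1) * of_real (alpha p (m + 1) ^ i * beta p m ^ j)"

definition G :: "weights \<Rightarrow> weights \<Rightarrow> weights \<Rightarrow> nat \<Rightarrow> nat \<Rightarrow> complex \<Rightarrow> complex" where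
  "G p h v i j z = (\<Sum>\<^sub>\<infinity>m. G_term p h v i j z m)"

end

theory Submission
  imports Defs
begin

text \<open>
  Each monomial \<open>\<alpha>\<^sup>i \<beta>\<^sup>j\<close> with \<open>(\<alpha>, \<beta>)\<close> on the kernel curve is harmonic in the interior.
  The coefficients are chosen so that consecutive monomials cancel on the axes: the terms with
  positive index satisfy the horizontal boundary condition exactly and leave the residual
  \<open>-(1 - z)\<close> on the vertical axis, the terms with negative index behave symmetrically, and
  the constant term 1 contributes \<open>1 - z\<close> on both axes. Hence \<open>G\<close> solves the equations of \<open>F\<close>, and
  \<open>\<bar>G - 1\<bar>\<close> is bounded by a multiple of \<open>W(i, j) = a\<^sup>i + b\<^sup>j\<close> for suitable \<open>a, b < 1\<close>. This \<open>W\<close>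
  decays geometrically along the walk, at a uniform rate even on the axes. So the walk has finitely
  many contacts almost surely, and in \<open>G(x) = E (z\<^sup>N G(S\<^sub>n))\<close>, where \<open>N\<close> counts the contacts before time
  \<open>n\<close>, the factor \<open>G(S\<^sub>n)\<close> may be replaced by 1 in the limit.

  Convexity of the transform of \<open>p\<close> in each variable separately replaces the geometry of the kernel curve.
  Exchanging the two coordinates maps \<open>v\<close> to \<open>u\<close> and negative indices to positive ones.
\<close>

section \<open>Convexity in one variable\<close>

text \<open>Singularity means that no interior step lowers the sum of the coordinates. So the
  transform is below 1 on the diagonal inside the unit square and increases along it, and this
  forces \<open>a_seq p\<close> to shrink from index 1 on by the fixed factor
  \<open>contraction\<close>. The coefficients meanwhile grow by ratios whose bounds tend to 1. The
  series therefore converges absolutely for all \<open>z\<close> in the closed disc, at every state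
  except the origin, where the monomials do not decay; no step leads to the origin. The bases of
  \<open>W\<close> need a margin on both sides. With base \<open>a_seq p 1\<close> the monomial is
  harmonic in the interior and does not decay, and with base 1 it is constant. A base strictly
  between decays and still dominates the terms of \<open>G - 1\<close>. The transform may diverge
  and may be discontinuous at the edge of its convergence domain. Hence the maximum of
  \<open>u_fun p\<close> is taken from a compact sublevel set whose closedness rests on Fatou's
  lemma, and roots are located from one-sided convexity estimates.\<close>

lemma convex_on_power_nonneg: "convex_on {0::real..} (\<lambda>x. x ^ n)"
proof (cases "even n")
  case True
  show ?thesis
    by (rule convex_on_subset[OF convex_power_even[OF True] subset_UNIV]) simp
next
  case False
  then show ?thesis
    by (rule convex_power_odd)
qed

text \<open>The exponent -1 is the lowest that occurs, as an interior step lowers a coordinate by at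
  most one.\<close>

lemma convex_on_powi:
  assumes "k \<ge> -1"
  shows "convex_on {0::real<..} (\<lambda>x. x powi k)"
proof (cases "k = -1")
  case True
  have "convex_on {0::real<..} inverse"
    by (rule convex_on_inverse) simp_all
  then show ?thesis
    using True by (simp add: power_int_minus)
next
  case False
  then obtain n where n: "k = int n"
    using assms zero_le_imp_eq_int[of k] by fastforce
  have "convex_on {0::real<..} (\<lambda>x. x ^ n)"
    by (rule convex_on_subset[OF convex_on_power_nonneg]) (simp_all add: subset_iff)
  then show ?thesis
    by (simp add: n)
qed

text \<open>Both weights of an interior point are positive, so strictness at a single endpoint
  survives.\<close>

lemma convex_on_mixture_less:
  fixes f :: "real \<Rightarrow> real"
  assumes "convex_on A f" "x \<in> A" "y \<in> A" "x < w" "w < y" "f x \<le> c" "f y \<le> c" "f x < c \<or> f y < c"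
  shows "f w < c"
proof -
  define t where "t = (w - x) / (y - x)"
  have t: "0 < t" "t < 1"
    using assms by (auto simp: t_def divide_simps)
  have "w = (1 - t) *\<^sub>R x + t *\<^sub>R y"
    using assms(4,5) by (simp add: t_def divide_simps) (simp add: algebra_simps)
  then have "f w \<le> (1 - t) * f x + t * f y"
    using convex_onD[OF assms(1), of t x y] t assms by simp
  also have "\<dots> < c"
  proof (cases "f x < c")
    case True
    have "(1 - t) * f x < (1 - t) * c" "t * f y \<le> t * c"
      using t True assms by auto
    then show ?thesis by (simp add: algebra_simps)
  next
    case False
    then have "(1 - t) * f x \<le> (1 - t) * c" "t * f y < t * c"
      using t assms by auto
    then show ?thesis by (simp add: algebra_simps)
  qed
  finally show ?thesis .
qed

lemma mixture_below:
  fixes u v c :: real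
  assumes "u < c"
  obtains t where "0 < t" "t < 1" "(1 - t) * u + t * v < c"
proof -
  have "((\<lambda>t. (1 - t) * u + t * v) \<longlongrightarrow> (1 - 0) * u + 0 * v) (at_right 0)"
    by (intro tendsto_intros)
  then have "\<forall>\<^sub>F t in at_right 0. (1 - t) * u + t * v < c"
    using assms by (intro order_tendstoD) auto
  moreover have "\<forall>\<^sub>F t in at_right (0::real). t \<in> {0<..<1}"
    by (rule eventually_at_right_real) simp
  ultimately have "\<forall>\<^sub>F t in at_right 0. (1 - t) * u + t * v < c \<and> t \<in> {0<..<1}"
    by eventually_elim simp
  then show ?thesis
    using that eventually_happens'[OF trivial_limit_at_right_real] by force
qed

text \<open>Convexity gives no continuity at an endpoint of the domain, but the chord bounds
  \<open>f\<close> from above near \<open>a\<close>. So a value below \<open>c\<close> at an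
  endpoint can be moved inside.\<close>

lemma convex_on_near_less:
  fixes f :: "real \<Rightarrow> real"
  assumes "convex_on A f" "a \<in> A" "b \<in> A" "a \<noteq> b" "f a < c"
  obtains w where "w \<in> open_segment a b" "f w < c"
proof -
  obtain t where t: "0 < t" "t < 1" "(1 - t) * f a + t * f b < c"
    using mixture_below[OF assms(5)] by blast
  let ?w = "(1 - t) *\<^sub>R a + t *\<^sub>R b"
  have "f ?w \<le> (1 - t) * f a + t * f b"
    using convex_onD[OF assms(1), of t a b] t assms by simp
  moreover have "?w \<in> open_segment a b"
    using t assms by (auto simp: in_segment)
  ultimately show ?thesis
    using that t by force
qed

text \<open>The pole of the lower bound pushes \<open>f\<close> above 1 near 0. The intermediate
  value theorem is applied on an interval that stops before \<open>a\<close>, where \<open>f\<close>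
  may jump.\<close>

lemma convex_on_root:
  fixes f :: "real \<Rightarrow> real"
  assumes cvx: "convex_on {0<..a} f" and "0 < a" and fa: "f a < 1"
    and "c > 0" and low: "\<And>x. 0 < x \<Longrightarrow> x \<le> a \<Longrightarrow> c / x \<le> f x"
  obtains x where "0 < x" "x < a" "f x = 1"
proof -
  \<comment> \<open>\<open>c / 2\<close> makes the lower bound at least 2, and \<open>a / 2\<close>
    keeps the point inside the interval.\<close>
  define x0 where "x0 = min (c / 2) (a / 2)"
  have x0: "0 < x0" "x0 < a" "x0 \<le> c / 2"
    using assms by (auto simp: x0_def)
  have "2 \<le> c / x0"
    using x0 by (simp add: field_simps)
  then have f0: "f x0 \<ge> 2"
    using low[of x0] x0 by auto
  obtain w where "w \<in> open_segment a x0" and fw: "f w < 1"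
    using convex_on_near_less[OF cvx, of a x0 1] x0 fa by auto
  then have w: "x0 < w" "w < a"
    using x0 by (auto simp: open_segment_eq_real_ivl)
  have "continuous_on {0<..<a} f"
    by (rule convex_on_continuous) (auto intro: convex_on_subset[OF cvx])
  then have "continuous_on {x0..w} f"
    by (rule continuous_on_subset) (use x0 w in auto)
  then obtain x where "x0 \<le> x" "x \<le> w" "f x = 1"
    using IVT2'[of f w 1 x0] f0 fw w by auto
  then show ?thesis
    using that[of x] x0 w by auto
qed

section \<open>Generating functions of the weights and the exchange of coordinates\<close>

lemma pmf_summable_on_iff:
  fixes f :: "'a \<Rightarrow> real"
  shows "(\<lambda>x. pmf p x * f x) summable_on UNIV \<longleftrightarrow> integrable (measure_pmf p) f"
proof -
  have "(\<lambda>x. pmf p x * f x) summable_on UNIV \<longleftrightarrow> integrable (count_space UNIV) (\<lambda>x. pmf p x * f x)"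
    unfolding abs_summable_equivalent[symmetric] abs_summable_on_def[symmetric]
    by (rule summable_on_iff_abs_summable_on_real)
  also have "\<dots> \<longleftrightarrow> integrable (measure_pmf p) f"
    unfolding measure_pmf_eq_density by (subst integrable_density) auto
  finally show ?thesis .
qed

text \<open>No convergence is assumed: without it both sides have the default value 0.\<close>

lemma pmf_infsum_eq_integral:
  fixes f :: "'a \<Rightarrow> real"
  shows "(\<Sum>\<^sub>\<infinity>x. pmf p x * f x) = measure_pmf.expectation p f"
proof (cases "integrable (measure_pmf p) f")
  case True
  then have "(\<lambda>x. pmf p x * f x) summable_on UNIV"
    by (simp add: pmf_summable_on_iff)
  then have "infsetsum (\<lambda>x. pmf p x * f x) UNIV = (\<Sum>\<^sub>\<infinity>x. pmf p x * f x)"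
    by (intro infsetsum_infsum iffD1[OF abs_summable_equivalent]
        iffD1[OF summable_on_iff_abs_summable_on_real])
  then show ?thesis
    by (simp add: infsetsum_def measure_pmf_eq_density integral_density)
next
  case False
  then have "\<not> (\<lambda>x. pmf p x * f x) summable_on UNIV"
    by (simp add: pmf_summable_on_iff)
  then show ?thesis
    using False by (simp add: infsum_not_exists not_integrable_integral_eq)
qed

definition monomial2 :: "real \<Rightarrow> real \<Rightarrow> int \<times> int \<Rightarrow> real" where
  "monomial2 a b = (\<lambda>(k, l). a powi k * b powi l)"

lemma monomial2_apply [simp]: "monomial2 a b (k, l) = a powi k * b powi l"
  by (simp add: monomial2_def)

lemma weight_gf_eq_integral: "weight_gf w a b = measure_pmf.expectation w (monomial2 a b)"
proof -
  have "weight_gf w a b = (\<Sum>\<^sub>\<infinity>x. pmf w x * monomial2 a b x)"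
    unfolding weight_gf_def by (intro infsum_cong) (auto simp: mult.assoc)
  then show ?thesis
    by (simp add: pmf_infsum_eq_integral)
qed

section \<open>Exchange of the two coordinates\<close>

definition swap_w :: "weights \<Rightarrow> weights" where
  "swap_w = map_pmf prod.swap"

lemma pmf_swap_w: "pmf (swap_w p) (k, l) = pmf p (l, k)"
proof -
  have "pmf (map_pmf prod.swap p) (prod.swap (l, k)) = pmf p (l, k)"
    by (rule pmf_map_inj') auto
  then show ?thesis by (simp add: swap_w_def)
qed

lemma swap_w_swap_w [simp]: "swap_w (swap_w p) = p"
  by (simp add: swap_w_def map_pmf_comp)

lemma infsum_swap_args: "(\<Sum>\<^sub>\<infinity>(k, l). f k l) = (\<Sum>\<^sub>\<infinity>(k, l). f l k)"
proof -
  have "(\<Sum>\<^sub>\<infinity>x. case_prod f x) = (\<Sum>\<^sub>\<infinity>x. case_prod f (prod.swap x))"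
    by (rule infsum_reindex_bij_betw[symmetric]) (simp add: bij_swap)
  then show ?thesis
    by (simp add: case_prod_unfold)
qed

lemma summable_on_swap_args:
  "(\<lambda>(k, l). f k l) summable_on UNIV \<longleftrightarrow> (\<lambda>(k, l). f l k) summable_on UNIV"
proof -
  have "(\<lambda>x. case_prod f (prod.swap x)) summable_on UNIV \<longleftrightarrow> case_prod f summable_on UNIV"
    by (rule summable_on_reindex_bij_betw) (simp add: bij_swap)
  then show ?thesis
    by (simp add: case_prod_unfold)
qed

lemma weight_gf_swap: "weight_gf (swap_w w) a b = weight_gf w b a"
  unfolding weight_gf_def pmf_swap_w
  by (subst infsum_swap_args) (simp add: mult_ac)

lemma kernel_swap: "kernel (swap_w p) a b = kernel p b a"
proof -
  have "(\<Sum>\<^sub>\<infinity>(k, l)\<in>{-1..} \<times> {-1..}. pmf (swap_w p) (k, l) * a powi (k + 1) * b powi (l + 1)) =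
    (\<Sum>\<^sub>\<infinity>x\<in>prod.swap ` ({-1..} \<times> {-1..}). (case x of (k, l) \<Rightarrow> pmf (swap_w p) (k, l) * a powi (k + 1) * b powi (l + 1)))"
    by (simp add: product_swap)
  also have "\<dots> = (\<Sum>\<^sub>\<infinity>(k, l)\<in>{-1..} \<times> {-1..}. pmf p (k, l) * b powi (k + 1) * a powi (l + 1))"
    by (subst infsum_reindex) (auto simp: o_def case_prod_unfold pmf_swap_w mult_ac intro!: infsum_cong inj_onI)
  finally show ?thesis
    by (simp add: kernel_def mult.commute)
qed

lemma v_fun_swap: "v_fun p = u_fun (swap_w p)"
  by (simp add: fun_eq_iff v_fun_def u_fun_def kernel_swap)

lemma v_star_swap: "v_star p = u_star (swap_w p)"
  by (simp add: v_star_def u_star_def beta_tilde_def alpha_hat_def v_fun_swap)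

lemma infsum_mean_swap:
  "(\<Sum>\<^sub>\<infinity>(k, l). of_int k * pmf (swap_w w) (k, l)) = (\<Sum>\<^sub>\<infinity>(k, l). of_int l * pmf w (k, l) :: real)"
  "(\<Sum>\<^sub>\<infinity>(k, l). of_int l * pmf (swap_w w) (k, l)) = (\<Sum>\<^sub>\<infinity>(k, l). of_int k * pmf w (k, l) :: real)"
  unfolding pmf_swap_w by (rule infsum_swap_args)+

lemma summable_on_mean_swap:
  "(\<lambda>(k, l). of_int k * pmf (swap_w w) (k, l) :: real) summable_on UNIV \<longleftrightarrow>
    (\<lambda>(k, l). of_int l * pmf w (k, l) :: real) summable_on UNIV"
  "(\<lambda>(k, l). of_int l * pmf (swap_w w) (k, l) :: real) summable_on UNIV \<longleftrightarrow>
    (\<lambda>(k, l). of_int k * pmf w (k, l) :: real) summable_on UNIV"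
  unfolding pmf_swap_w by (rule summable_on_swap_args)+

text \<open>The horizontal axis becomes the vertical one, so the swapped \<open>v\<close> takes the
  place of \<open>h\<close> and conversely. Interpreting the locale at the swapped weights yields
  the mirror image of every later result.\<close>

lemma (in singular_quadrant_data) swapped:
  "singular_quadrant_data (swap_w p) (swap_w v) (swap_w h) (swap_w q)"
proof
  show "pmf (swap_w p) (k, l) = 0" if "k \<le> - 2 \<or> l \<le> - 2" for k l
    using that p_support[of l k] by (auto simp: pmf_swap_w)
  show "pmf (swap_w p) (-1, -1) = 0" "pmf (swap_w p) (-1, 0) = 0" "pmf (swap_w p) (0, -1) = 0"
    using p_singular by (auto simp: pmf_swap_w)
  show "pmf (swap_w p) (- 1, 1) * pmf (swap_w p) (1, - 1) \<noteq> 0"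
    using p_corners by (auto simp: pmf_swap_w)
  show "\<exists>k l. 0 < k + l \<and> 0 < pmf (swap_w p) (k, l)"
    using p_outward by (metis add.commute pmf_swap_w)
  show "\<forall>\<^sub>F w in nhds (x, y). laplace_term (swap_w p) (fst w) (snd w) summable_on UNIV"
    if "(\<Sum>\<^sub>\<infinity>kl. laplace_term (swap_w p) x y kl) = 1" for x y
  proof -
    have eq: "laplace_term (swap_w p) x y = (\<lambda>(k, l). pmf p (l, k) * exp (of_int l * y + of_int k * x))" for x y
      by (auto simp: laplace_term_def pmf_swap_w add.commute)
    have "(\<Sum>\<^sub>\<infinity>(k, l). pmf p (k, l) * exp (of_int k * y + of_int l * x)) = 1"
      using that unfolding eq by (subst infsum_swap_args)
    then have "(\<Sum>\<^sub>\<infinity>kl. laplace_term p y x kl) = 1"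
      unfolding laplace_term_def .
    then have ev: "\<forall>\<^sub>F w in nhds (y, x). laplace_term p (fst w) (snd w) summable_on UNIV"
      by (rule p_laplace)
    have "isCont (\<lambda>w. (snd w, fst w)) (x, y)"
      by (intro continuous_intros)
    \<comment> \<open>Summability near a point is carried along the continuous exchange of the two
      arguments.\<close>
    then have "filterlim (\<lambda>w. (snd w, fst w)) (nhds (y, x)) (nhds (x, y))"
      unfolding isCont_def by (subst (asm) tendsto_at_iff_tendsto_nhds) simp
    from eventually_compose_filterlim[OF ev this] show ?thesis
      unfolding eq laplace_term_def fst_conv snd_conv
      by (subst summable_on_swap_args) (simp add: case_prod_unfold pmf_swap_w add.commute)
  qed
  show "pmf w (k, l) = 0" if w: "w \<in> {swap_w v, swap_w h, swap_w q}" "k < 0 \<or> l < 0 \<or> (k, l) = (0, 0)" for w k l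
  proof -
    obtain w' where w': "w = swap_w w'" "w' \<in> {h, v, q}"
      using w(1) by blast
    then show ?thesis
      using reflection_support[OF w'(2), of l k] w(2) by (auto simp: pmf_swap_w)
  qed
qed (simp_all only: infsum_mean_swap summable_on_mean_swap h_means v_means q_means p_drift)

section \<open>The transform of the interior step law\<close>

text \<open>The point \<open>c\<close> rules out a function that stays at level 1 between
  \<open>a\<close> and \<open>b\<close>; its position is free, hence the cases. Left of
  \<open>a\<close>, a value at most 1 together with a smaller one right of \<open>a\<close> would
  pull \<open>f a\<close> below 1.\<close>

lemma convex_on_unit_level:
  fixes f :: "real \<Rightarrow> real"
  assumes cvx: "convex_on {0<..b} f" and a: "0 < a" "a < b" "f a = 1" and fb: "f b \<le> 1"
    and c: "0 < c" "c \<le> b" "f c < 1"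
  shows "\<And>x. a < x \<Longrightarrow> x < b \<Longrightarrow> f x < 1" and "\<And>x. 0 < x \<Longrightarrow> x < a \<Longrightarrow> 1 < f x"
proof -
  have 1: "f x < 1" if x: "a < x" "x < b" for x
  proof -
    consider "c = b" | "c < b" "c < a" | "c < b" "a < c" "x < c" | "x = c" | "c < b" "a < c" "c < x"
      using a c x by force
    then show ?thesis
    proof cases
      case 1
      then show ?thesis
        using convex_on_mixture_less[OF cvx, of a b x 1] a c x by auto
    next
      \<comment> \<open>This case is void: \<open>a\<close> lies between \<open>c\<close> and
        \<open>b\<close>, so \<open>f a\<close> would be below 1.\<close>
      case 2
      then show ?thesis
        using convex_on_mixture_less[OF cvx, of c b a 1] a c x fb by auto
    next
      case 3
      then show ?thesis
        using convex_on_mixture_less[OF cvx, of a c x 1] a c x by auto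
    next
      case 4
      then show ?thesis
        using c by simp
    next
      case 5
      then show ?thesis
        using convex_on_mixture_less[OF cvx, of c b x 1] a c x fb by auto
    qed
  qed
  show "\<And>x. a < x \<Longrightarrow> x < b \<Longrightarrow> f x < 1"
    by (rule 1)
  show "1 < f x" if x: "0 < x" "x < a" for x
  proof (rule ccontr)
    assume "\<not> 1 < f x"
    moreover obtain y where "a < y" "y < b"
      using dense a(2) by blast
    ultimately show False
      using convex_on_mixture_less[OF cvx, of x y a 1] 1[of y] x a by auto
  qed
qed

lemma pmf_expectation_ge_single:
  fixes f :: "'a \<Rightarrow> real"
  assumes "integrable (measure_pmf w) f" "\<And>x. x \<in> set_pmf w \<Longrightarrow> 0 \<le> f x" "0 \<le> f y"
  shows "pmf w y * f y \<le> measure_pmf.expectation w f"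
proof -
  have "pmf w y * f y = measure_pmf.expectation w (\<lambda>x. indicator {y} x * f y)"
    by (simp add: measure_pmf_single)
  also have "\<dots> \<le> measure_pmf.expectation w f"
  proof (rule integral_mono_AE)
    show "integrable (measure_pmf w) (\<lambda>x. indicator {y} x * f y)"
      by (intro integrable_mult_left integrable_real_indicator) (simp_all add: less_top[symmetric])
  qed (use assms in \<open>auto simp: AE_measure_pmf_iff indicator_def\<close>)
  finally show ?thesis .
qed

lemma integrable_swap_w:
  "integrable (measure_pmf (swap_w w)) (monomial2 a b) \<longleftrightarrow> integrable (measure_pmf w) (monomial2 b a)"
proof -
  have "(\<lambda>x. monomial2 a b (prod.swap x)) = monomial2 b a"
    by (auto simp: fun_eq_iff mult.commute)
  then show ?thesis
    by (simp add: swap_w_def)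
qed

text \<open>After multiplication by \<open>a\<close> this compares powers with the nonnegative
  exponent \<open>k + 1\<close>. The factor \<open>c / a\<close> is the price of the exponent -1; it
  later becomes the contraction rate.\<close>

lemma powi_le_scaled:
  fixes a c :: real
  assumes "-1 \<le> k" "0 < a" "a \<le> c"
  shows "a powi k \<le> (c / a) * c powi k"
proof -
  obtain n where n: "k + 1 = int n"
    using assms zero_le_imp_eq_int[of "k + 1"] by auto
  have *: "x powi k = x ^ n / x" if "x > 0" for x :: real
  proof -
    have "x powi (k + 1) = x powi k * x"
      using that by (simp add: power_int_add)
    then show ?thesis
      using that by (simp add: n)
  qed
  have "a ^ n \<le> c ^ n"
    using assms by (intro power_mono) auto
  then show ?thesis
    using assms by (simp add: * field_simps)
qed

text \<open>A divergent transform has the value 0, so the value 1 certifies convergence.\<close>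

lemma weight_gf_eq_1_integrable:
  assumes "weight_gf w a b = 1"
  shows "integrable (measure_pmf w) (monomial2 a b)"
  using assms not_integrable_integral_eq by (force simp: weight_gf_eq_integral)

context singular_quadrant_data
begin

abbreviation p_conv :: "real \<Rightarrow> real \<Rightarrow> bool" where
  "p_conv a b \<equiv> integrable (measure_pmf p) (monomial2 a b)"

text \<open>The third bound is the singularity of the walk: a step of -1 in one coordinate comes
  with at least +1 in the other.\<close>

lemma p_set:
  assumes "(k, l) \<in> set_pmf p"
  shows "-1 \<le> k" "-1 \<le> l" "0 \<le> k + l"
proof -
  have "pmf p (k, l) \<noteq> 0"
    using assms by (simp add: set_pmf_iff)
  then have "\<not> (k \<le> -2 \<or> l \<le> -2)" "\<not> (k = -1 \<and> l = -1)" "\<not> (k = -1 \<and> l = 0)" "\<not> (k = 0 \<and> l = -1)"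
    using p_support p_singular by metis+
  then show "-1 \<le> k" "-1 \<le> l" "0 \<le> k + l"
    by linarith+
qed

lemma p_conv_mono:
  assumes "p_conv c b" "0 < a" "a \<le> c" "0 < b"
  shows "p_conv a b" "weight_gf p a b \<le> (c / a) * weight_gf p c b"
proof -
  have le: "monomial2 a b x \<le> (c / a) * monomial2 c b x" "0 \<le> monomial2 a b x" if "x \<in> set_pmf p" for x
  proof -
    obtain k l where x: "x = (k, l)" by force
    have "a powi k * b powi l \<le> (c / a) * c powi k * b powi l"
      using p_set[of k l] that assms by (intro mult_right_mono powi_le_scaled) (auto simp: x)
    then show "monomial2 a b x \<le> (c / a) * monomial2 c b x"
      by (simp add: x mult.assoc)
    show "0 \<le> monomial2 a b x"
      using assms by (simp add: x)
  qed
  have int: "integrable (measure_pmf p) (\<lambda>x. (c / a) * monomial2 c b x)"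
    using assms by simp
  show "p_conv a b"
  proof (rule Bochner_Integration.integrable_bound[OF int])
    show "AE x in measure_pmf p. norm (monomial2 a b x) \<le> norm ((c / a) * monomial2 c b x)"
      unfolding AE_measure_pmf_iff
      using le by (metis abs_ge_self abs_of_nonneg order_trans real_norm_def)
  qed simp
  then have "measure_pmf.expectation p (monomial2 a b) \<le>
      measure_pmf.expectation p (\<lambda>x. (c / a) * monomial2 c b x)"
    using int le by (intro integral_mono_AE) (auto simp: AE_measure_pmf_iff)
  then show "weight_gf p a b \<le> (c / a) * weight_gf p c b"
    by (simp add: weight_gf_eq_integral)
qed

lemma p_conv_mono2:
  assumes "p_conv a d" "0 < a" "0 < b" "b \<le> d"
  shows "p_conv a b" "weight_gf p a b \<le> (d / b) * weight_gf p a d"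
proof -
  interpret sw: singular_quadrant_data "swap_w p" "swap_w v" "swap_w h" "swap_w q"
    by (rule swapped)
  show "p_conv a b" "weight_gf p a b \<le> (d / b) * weight_gf p a d"
    using sw.p_conv_mono[of d a b] assms by (simp_all add: integrable_swap_w weight_gf_swap)
qed

lemma monomial2_1_1: "monomial2 1 1 = (\<lambda>_. 1)"
  by (auto simp: fun_eq_iff)

lemma p_conv_1: "p_conv 1 1" and weight_gf_1_1: "weight_gf w 1 1 = 1"
  by (simp_all add: monomial2_1_1 weight_gf_eq_integral)

lemma p_conv_le_1: "0 < a \<Longrightarrow> a \<le> 1 \<Longrightarrow> 0 < b \<Longrightarrow> b \<le> 1 \<Longrightarrow> p_conv a b"
  using p_conv_mono(1)[OF p_conv_1] p_conv_mono2(1) by (metis zero_less_one)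

text \<open>The monomial of the step (-1, 1) is \<open>b / a\<close>. Its blow-up for small
  \<open>a\<close> produces roots of the transform and bounds its sublevel sets.\<close>

lemma weight_gf_corner:
  assumes "p_conv a b" "0 < a" "0 < b"
  shows "pmf p (-1, 1) * b / a \<le> weight_gf p a b"
proof -
  have "pmf p (-1, 1) * monomial2 a b (-1, 1) \<le> weight_gf p a b"
    unfolding weight_gf_eq_integral using assms
    by (intro pmf_expectation_ge_single) (auto simp: monomial2_def)
  then show ?thesis
    by (simp add: power_int_minus field_simps)
qed

lemma corner_pos: "0 < pmf p (-1, 1)" "0 < pmf p (1, -1)"
  using p_corners by (metis mult_zero_left mult_zero_right order_le_less pmf_nonneg)+

text \<open>On the diagonal a step contributes \<open>a\<close> to the power \<open>k + l\<close>:
  at most 1 by \<open>p_set\<close>, and less than 1 for the outward step.\<close>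

lemma weight_gf_diagonal:
  assumes a: "0 < a" "a < 1"
  shows "weight_gf p a a < 1"
proof -
  obtain k l where kl: "k + l > 0" "pmf p (k, l) > 0"
    using p_outward by blast
  have powi: "a powi k * a powi l = a powi (k + l)" for k l
    using a by (simp add: power_int_add)
  have le1: "a powi m \<le> 1" if "0 \<le> m" for m
    using that a by (simp add: power_int_def power_le_one)
  have lt1: "a powi m < 1" if "0 < m" for m
    using that a by (simp add: power_int_def power_Suc_less_one power_less_one_iff)
  have conv: "p_conv a a"
    using a by (intro p_conv_le_1) auto
  have "pmf p (k, l) * (1 - monomial2 a a (k, l)) \<le> measure_pmf.expectation p (\<lambda>x. 1 - monomial2 a a x)"
  proof (rule pmf_expectation_ge_single)
    show "0 \<le> 1 - monomial2 a a x" if "x \<in> set_pmf p" for x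
      using that p_set(3) by (cases x) (auto simp: powi intro!: le1)
    show "0 \<le> 1 - monomial2 a a (k, l)"
      using kl by (auto simp: powi intro!: le1)
  qed (use conv in simp)
  moreover have "0 < pmf p (k, l) * (1 - monomial2 a a (k, l))"
    using kl lt1[of "k + l"] by (simp add: powi)
  ultimately show ?thesis
    using conv by (simp add: weight_gf_eq_integral)
qed

lemma convex_on_weight_gf:
  assumes "p_conv c b" "0 < b"
  shows "convex_on {0<..c} (\<lambda>a. weight_gf p a b)"
proof (rule convex_onI)
  fix t x y :: real
  assume t: "0 < t" "t < 1" and xy: "x \<in> {0<..c}" "y \<in> {0<..c}"
  let ?w = "(1 - t) *\<^sub>R x + t *\<^sub>R y"
  have "?w \<in> {0<..c}"
    using xy t by (intro convexD) auto
  then have conv: "p_conv x b" "p_conv y b" "p_conv ?w b" "0 < ?w"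
    using xy assms p_conv_mono(1) by auto
  have "monomial2 ?w b z \<le> (1 - t) * monomial2 x b z + t * monomial2 y b z" if "z \<in> set_pmf p" for z
  proof -
    obtain k l where z: "z = (k, l)" by force
    have "?w powi k \<le> (1 - t) * x powi k + t * y powi k"
      using convex_onD[OF convex_on_powi[of k], of t x y] p_set(1)[of k l] that t xy by (auto simp: z)
    then have "?w powi k * b powi l \<le> ((1 - t) * x powi k + t * y powi k) * b powi l"
      using assms by (intro mult_right_mono) auto
    then show ?thesis
      by (simp add: z algebra_simps)
  qed
  then have "measure_pmf.expectation p (monomial2 ?w b) \<le>
      measure_pmf.expectation p (\<lambda>z. (1 - t) * monomial2 x b z + t * monomial2 y b z)"
    using conv by (intro integral_mono_AE) (auto simp: AE_measure_pmf_iff)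
  also have "\<dots> = (1 - t) * weight_gf p x b + t * weight_gf p y b"
    using conv by (simp add: weight_gf_eq_integral)
  finally show "weight_gf p ?w b \<le> (1 - t) * weight_gf p x b + t * weight_gf p y b"
    by (simp add: weight_gf_eq_integral)
qed auto

lemma convex_on_weight_gf2:
  assumes "p_conv a d" "0 < a"
  shows "convex_on {0<..d} (weight_gf p a)"
proof -
  interpret sw: singular_quadrant_data "swap_w p" "swap_w v" "swap_w h" "swap_w q"
    by (rule swapped)
  show ?thesis
    using sw.convex_on_weight_gf[of d a] assms by (simp add: integrable_swap_w weight_gf_swap)
qed

text \<open>The origin lies on the curve of the Laplace condition, since the weights sum to 1.
  Exponentials of a neighbouring point lie beyond 1.\<close>

lemma p_conv_beyond_1: obtains e where "1 < e" "p_conv e e"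
proof -
  have lap: "laplace_term p s s = (\<lambda>x. pmf p x * monomial2 (exp s) (exp s) x)" for s
    by (auto simp: laplace_term_def fun_eq_iff exp_power_int exp_add mult.commute)
  have "(\<Sum>\<^sub>\<infinity>x. laplace_term p 0 0 x) = 1"
    unfolding lap pmf_infsum_eq_integral by (simp add: monomial2_1_1)
  then have "\<forall>\<^sub>F w in nhds (0, 0). laplace_term p (fst w) (snd w) summable_on UNIV"
    by (rule p_laplace)
  then obtain d where d: "d > 0" "\<And>w. dist w (0, 0) < d \<Longrightarrow> laplace_term p (fst w) (snd w) summable_on UNIV"
    unfolding eventually_nhds_metric by blast
  \<comment> \<open>The point \<open>(s, s)\<close> has norm \<open>s\<close> times the square root
    of 2, which is less than \<open>d\<close>.\<close>
  define s where "s = d / 2"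
  have "dist (s, s) (0, 0) \<le> \<bar>s\<bar> * sqrt 2"
    by (simp add: dist_Pair_Pair real_sqrt_mult flip: mult_2)
  also have "\<dots> < \<bar>s\<bar> * 2"
    using d(1) by (intro mult_strict_left_mono real_less_lsqrt) (auto simp: s_def)
  finally have "dist (s, s) (0, 0) < d"
    using d(1) by (simp add: s_def)
  from d(2)[OF this] have "p_conv (exp s) (exp s)"
    unfolding fst_conv snd_conv lap pmf_summable_on_iff .
  then show ?thesis
    using that[of "exp s"] d(1) by (simp add: s_def)
qed

text \<open>The left derivative at 1 of the transform with second argument 1 is the first drift,
  which is positive. \<open>f n\<close> is the difference quotient of a single step, and the limit
  passes under the expectation by dominated convergence.\<close>

lemma weight_gf_below_1:
  obtains a where "0 < a" "a < 1" "weight_gf p a 1 < 1"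
proof -
  let ?k = "\<lambda>x. real_of_int (fst x)"
  have drift: "(\<Sum>\<^sub>\<infinity>(k, l). of_int k * pmf p (k, l)) = (\<Sum>\<^sub>\<infinity>x. pmf p x * ?k x)"
    by (intro infsum_cong) (auto simp: mult.commute)
  then have mean: "measure_pmf.expectation p ?k > 0"
    using p_drift(1) by (simp add: pmf_infsum_eq_integral)
  \<comment> \<open>A positive expectation excludes the default value 0 of a non-integrable
    function.\<close>
  then have kint: "integrable (measure_pmf p) ?k"
    using not_integrable_integral_eq by force
  \<comment> \<open>The sequence starts at 1/2, so \<open>1 - s n\<close> is at least 1/2 and the
    quotient of a step -1 is bounded by 2.\<close>
  define s where "s n = inverse (real (Suc (Suc n)))" for n
  have s: "0 < s n" "s n \<le> 1/2" for n
    by (simp_all add: s_def field_simps)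
  define f where "f n x = (1 - (1 - s n) powi fst x) / s n" for n and x :: "int \<times> int"
  have "s \<longlonglongrightarrow> 0"
    unfolding s_def using LIMSEQ_ignore_initial_segment[OF LIMSEQ_inverse_real_of_nat, of 1] by simp
  then have "(\<lambda>n. - s n) \<longlonglongrightarrow> - 0"
    by (rule tendsto_minus)
  then have s0: "filterlim (\<lambda>n. - s n) (at 0) sequentially"
    using s(1) by (intro filterlim_atI) (auto simp: less_imp_neq[symmetric])
  have lim: "(\<lambda>n. f n x) \<longlonglongrightarrow> ?k x" for x
  proof -
    have "((\<lambda>x. x powi fst y) has_real_derivative of_int (fst y)) (at 1)" for y :: "int \<times> int"
      by (auto intro!: derivative_eq_intros)
    then have "((\<lambda>h::real. ((1 + h) powi fst x - 1) / h) \<longlongrightarrow> of_int (fst x)) (at 0)"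
      by (simp add: DERIV_def)
    from filterlim_compose[OF this s0] show ?thesis
      by (simp add: f_def minus_divide_right[symmetric] minus_divide_left)
  qed
  have bound: "\<bar>f n x\<bar> \<le> \<bar>?k x\<bar> + 2" if "x \<in> set_pmf p" for n x
  proof (cases "fst x = -1")
    case True
    have "f n x = - (1 / (1 - s n))"
      using s[of n] by (simp add: f_def True power_int_minus field_simps)
    moreover have "\<bar>1 / (1 - s n)\<bar> \<le> 2"
      using s[of n] by (simp add: field_simps)
    ultimately show ?thesis
      by (simp add: True)
  next
    case False
    then have "0 \<le> fst x"
      using p_set(1)[of "fst x" "snd x"] that by simp
    then obtain m where m: "fst x = int m"
      using zero_le_imp_eq_int by blast
    have "1 + real m * (- s n) \<le> (1 + - s n) ^ m"
      using s[of n] by (intro Bernoulli_inequality) auto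
    moreover have "(1 - s n) ^ m \<le> 1"
      using s[of n] by (intro power_le_one) auto
    ultimately have "0 \<le> f n x" "f n x \<le> real m"
      using s[of n] by (auto simp: f_def m field_simps)
    then show ?thesis
      by (simp add: m)
  qed
  have "(\<lambda>n. measure_pmf.expectation p (f n)) \<longlonglongrightarrow> measure_pmf.expectation p ?k"
    using kint lim bound
    by (intro integral_dominated_convergence[where w = "\<lambda>x. \<bar>?k x\<bar> + 2"]) (auto simp: AE_measure_pmf_iff)
  then have "\<forall>\<^sub>F n in sequentially. measure_pmf.expectation p (f n) > 0"
    using mean by (rule order_tendstoD)
  then obtain n where n: "measure_pmf.expectation p (f n) > 0"
    using eventually_happens by force
  have conv: "p_conv (1 - s n) 1"
    using s[of n] by (intro p_conv_le_1) auto
  have "f n = (\<lambda>x. (1 - monomial2 (1 - s n) 1 x) / s n)"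
    by (auto simp: f_def fun_eq_iff)
  then have "measure_pmf.expectation p (f n) = (1 - weight_gf p (1 - s n) 1) / s n"
    using conv by (simp add: weight_gf_eq_integral)
  then have "weight_gf p (1 - s n) 1 < 1"
    using n s[of n] by (simp add: zero_less_divide_iff)
  then show ?thesis
    using that[of "1 - s n"] s[of n] by auto
qed

end

section \<open>Roots of the kernel\<close>

lemma (in singular_quadrant_data) kernel_eq:
  assumes "0 < a" "0 < b"
  shows "kernel p a b = a * b * (weight_gf p a b - 1)"
proof -
  have "(\<Sum>\<^sub>\<infinity>(k, l)\<in>{-1..} \<times> {-1..}. pmf p (k, l) * a powi (k + 1) * b powi (l + 1)) =
      (\<Sum>\<^sub>\<infinity>(k, l). (a * b) * (pmf p (k, l) * a powi k * b powi l))"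
  proof (rule infsum_cong_neutral)
    fix x :: "int \<times> int"
    assume "x \<in> UNIV - {-1..} \<times> {-1..}"
    then have "pmf p x = 0"
      using p_support[of "fst x" "snd x"] by (cases x) auto
    then show "(case x of (k, l) \<Rightarrow> (a * b) * (pmf p (k, l) * a powi k * b powi l)) = 0"
      by (auto split: prod.split)
  qed (use assms in \<open>auto simp: power_int_add\<close>)
  also have "\<dots> = (\<Sum>\<^sub>\<infinity>x. (a * b) * (case x of (k, l) \<Rightarrow> pmf p (k, l) * a powi k * b powi l))"
    by (intro infsum_cong) auto
  also have "\<dots> = a * b * weight_gf p a b"
    unfolding weight_gf_def by (rule infsum_cmult_right')
  finally show ?thesis
    by (simp add: kernel_def algebra_simps)
qed

context singular_quadrant_data
begin

text \<open>As a function of its first argument the transform is at most 1 at the diagonal point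
  \<open>b\<close>. If \<open>b < 1\<close> it is strictly smaller there; if \<open>b = 1\<close>
  the point of strict inequality comes from the drift.\<close>

lemma weight_gf_around_root:
  assumes "0 < a" "a < b" "b \<le> 1" "weight_gf p a b = 1"
  shows "\<And>x. a < x \<Longrightarrow> x < b \<Longrightarrow> weight_gf p x b < 1"
    and "\<And>x. 0 < x \<Longrightarrow> x < a \<Longrightarrow> 1 < weight_gf p x b"
proof -
  have cvx: "convex_on {0<..b} (\<lambda>a. weight_gf p a b)"
    using assms by (intro convex_on_weight_gf p_conv_le_1) auto
  have b: "weight_gf p b b \<le> 1"
    using weight_gf_diagonal[of b] weight_gf_1_1 assms by (cases "b = 1") auto
  obtain c where c: "0 < c" "c \<le> b" "weight_gf p c b < 1"
  proof (cases "b = 1")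
    case True
    obtain c where "0 < c" "c < 1" "weight_gf p c 1 < 1"
      by (rule weight_gf_below_1)
    then show ?thesis
      by (intro that[of c]) (simp_all add: True)
  next
    case False
    then have "weight_gf p b b < 1"
      using assms by (intro weight_gf_diagonal) simp_all
    then show ?thesis
      using assms by (intro that[of b]) simp_all
  qed
  show "\<And>x. a < x \<Longrightarrow> x < b \<Longrightarrow> weight_gf p x b < 1"
    by (rule convex_on_unit_level(1)[OF cvx assms(1,2,4) b c])
  show "\<And>x. 0 < x \<Longrightarrow> x < a \<Longrightarrow> 1 < weight_gf p x b"
    by (rule convex_on_unit_level(2)[OF cvx assms(1,2,4) b c])
qed

lemma weight_gf_root_to_left:
  assumes "0 < a" "0 < b" "p_conv a b" "weight_gf p a b < 1"
  obtains x where "0 < x" "x < a" "weight_gf p x b = 1"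
proof (rule convex_on_root[OF convex_on_weight_gf[OF assms(3,2)] assms(1,4)])
  show "0 < pmf p (-1, 1) * b"
    by (rule mult_pos_pos[OF corner_pos(1) assms(2)])
  show "pmf p (-1, 1) * b / x \<le> weight_gf p x b" if "0 < x" "x \<le> a" for x
    using that assms(2) p_conv_mono(1)[OF assms(3) that assms(2)] by (intro weight_gf_corner)
qed (rule that)

text \<open>The search to the left starts where the transform is below 1: at the diagonal point if
  \<open>b < 1\<close>, and at a point supplied by the drift if \<open>b = 1\<close>.\<close>

lemma weight_gf_root_exists:
  assumes b: "0 < b" "b \<le> 1"
  obtains a where "0 < a" "a < b" "weight_gf p a b = 1"
proof (cases "b = 1")
  case True
  obtain c where c: "0 < c" "c < 1" "weight_gf p c 1 < 1"
    by (rule weight_gf_below_1)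
  have "p_conv c 1"
    using c by (intro p_conv_le_1) simp_all
  then obtain a where "0 < a" "a < c" "weight_gf p a 1 = 1"
    by (rule weight_gf_root_to_left[OF c(1) zero_less_one _ c(3)])
  then show ?thesis
    by (intro that[of a]) (use c True in simp_all)
next
  case False
  then have lt: "weight_gf p b b < 1" and conv: "p_conv b b"
    using b weight_gf_diagonal[of b] p_conv_le_1[of b b] by simp_all
  show ?thesis
    by (rule weight_gf_root_to_left[OF b(1) b(1) conv lt]) (rule that)
qed

section \<open>The function \<open>u\<close>, its maximum and its inverse branch\<close>

lemma weight_gf_below_upper_root:
  assumes "0 < a" "a < 1" "a < y" "y < b" "p_conv a b" "weight_gf p a b \<le> 1"
  shows "weight_gf p a y < 1"
proof -
  have "a < b"
    using assms(3,4) by (rule less_trans)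
  then have ab: "a \<in> {0<..b}" "b \<in> {0<..b}"
    using assms(1) by simp_all
  have diag: "weight_gf p a a < 1"
    using assms(1,2) by (rule weight_gf_diagonal)
  \<comment> \<open>The convex function is compared between the diagonal point, strictly below level
    1, and \<open>b\<close>, at level at most 1.\<close>
  show ?thesis
    by (rule convex_on_mixture_less[OF convex_on_weight_gf2[OF assms(5,1)] ab assms(3,4)
        less_imp_le[OF diag] assms(6) disjI1[OF diag]])
qed

text \<open>Of two roots above the diagonal, the smaller would lie strictly between the diagonal and
  the larger, hence be below level 1.\<close>

lemma u_fun_eq:
  assumes "0 < a" "a < 1" "a < b" "weight_gf p a b = 1"
  shows "u_fun p a = b"
proof -
  have *: "(a < y \<and> kernel p a y = 0) \<longleftrightarrow> (a < y \<and> weight_gf p a y = 1)" for y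
  proof (cases "a < y")
    case True
    then show ?thesis
      using assms by (simp add: kernel_eq)
  qed simp
  have "y = b" if y: "a < y" "weight_gf p a y = 1" for y
  proof (rule ccontr)
    assume "y \<noteq> b"
    then consider "y < b" | "b < y" by force
    then show False
    proof cases
      case 1
      then show ?thesis
        using weight_gf_below_upper_root[OF assms(1,2) y(1) 1 weight_gf_eq_1_integrable[OF assms(4)]]
          assms(4) y(2) by simp
    next
      case 2
      then show ?thesis
        using weight_gf_below_upper_root[OF assms(1,2,3) 2 weight_gf_eq_1_integrable[OF y(2)]]
          assms(4) y(2) by simp
    qed
  qed
  then have "\<exists>!y. a < y \<and> weight_gf p a y = 1" "(THE y. a < y \<and> weight_gf p a y = 1) = b"
    using assms(3,4) by blast+
  then show ?thesis
    using assms by (simp add: u_fun_def *)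
qed

lemma u_fun_cases:
  assumes "0 < a" "a < 1"
  obtains "u_fun p a = 0" | "a < u_fun p a" "weight_gf p a (u_fun p a) = 1"
proof (cases "\<exists>!b. b > a \<and> kernel p a b = 0")
  case True
  then obtain b where b: "b > a" "kernel p a b = 0"
    by blast
  then have "weight_gf p a b = 1"
    using assms by (simp add: kernel_eq)
  then show ?thesis
    using that b u_fun_eq[of a b] assms by auto
next
  case False
  then show ?thesis
    using that assms by (simp add: u_fun_def)
qed

text \<open>The corner step gives boundedness. Closedness comes from Fatou's lemma, which copes with
  a transform that is discontinuous at the edge of its convergence domain. Convergence must be part
  of the set, because a divergent transform has the value 0.\<close>

lemma compact_sublevel:
  "compact {(a, b). 0 < a \<and> a \<le> 1 \<and> 1 \<le> b \<and> p_conv a b \<and> weight_gf p a b \<le> 1}" (is "compact ?T")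
proof -
  let ?c = "pmf p (-1, 1)"
  have c: "0 < ?c"
    by (rule corner_pos)
  have sub: "?T \<subseteq> {?c..1} \<times> {1..1 / ?c}"
  proof (rule subsetI)
    fix x
    assume "x \<in> ?T"
    then obtain a b where x: "x = (a, b)"
      and ab: "0 < a" "a \<le> 1" "1 \<le> b" "p_conv a b" "weight_gf p a b \<le> 1"
      by blast
    then have "?c * b / a \<le> 1"
      using weight_gf_corner[of a b] by (meson less_le_trans order_trans zero_less_one)
    \<comment> \<open>Together with \<open>1 \<le> b\<close> and \<open>a \<le> 1\<close> this
      bounds \<open>a\<close> from below by \<open>?c\<close> and \<open>b\<close> from above by
      \<open>1 / ?c\<close>.\<close>
    then have le: "?c * b \<le> a"
      using ab(1) by (simp add: pos_divide_le_eq)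
    moreover have "?c * 1 \<le> ?c * b"
      using ab(3) by (intro mult_left_mono) auto
    ultimately have "?c \<le> a" "?c * b \<le> 1"
      using ab(2) by linarith+
    then show "x \<in> {?c..1} \<times> {1..1 / ?c}"
      using ab c by (simp add: x field_simps)
  qed
  have "closed ?T"
    unfolding closed_sequential_limits
  proof (intro allI impI, elim conjE)
    fix z and l :: "real \<times> real"
    assume zT: "\<forall>n. z n \<in> ?T" and lim: "z \<longlonglongrightarrow> l"
    obtain a b where l: "l = (a, b)" by force
    have "l \<in> {?c..1} \<times> {1..1 / ?c}"
    proof (rule closed_sequentially[OF _ _ lim])
      show "z n \<in> {?c..1} \<times> {1..1 / ?c}" for n
        by (rule subsetD[OF sub spec[OF zT]])
    qed (intro closed_Times closed_atLeastAtMost)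
    then have ab: "0 < a" "a \<le> 1" "1 \<le> b"
      using c by (auto simp: l)
    have lims: "(\<lambda>n. fst (z n)) \<longlonglongrightarrow> a" "(\<lambda>n. snd (z n)) \<longlonglongrightarrow> b"
      using tendsto_fst[OF lim] tendsto_snd[OF lim] by (simp_all add: l)
    have mono_lim: "(\<lambda>n. monomial2 (fst (z n)) (snd (z n)) x) \<longlonglongrightarrow> monomial2 a b x" for x
      using lims ab by (cases x) (auto intro!: tendsto_intros)
    have nonneg: "0 \<le> monomial2 a b x" for x
      using ab by (cases x) auto
    have "(\<integral>\<^sup>+x. ennreal (monomial2 a b x) \<partial>measure_pmf p) =
        (\<integral>\<^sup>+x. liminf (\<lambda>n. ennreal (monomial2 (fst (z n)) (snd (z n)) x)) \<partial>measure_pmf p)"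
      using mono_lim by (intro nn_integral_cong lim_imp_Liminf[symmetric] tendsto_ennrealI) auto
    also have "\<dots> \<le> liminf (\<lambda>n. \<integral>\<^sup>+x. ennreal (monomial2 (fst (z n)) (snd (z n)) x) \<partial>measure_pmf p)"
      by (rule nn_integral_liminf) simp
    also have "\<dots> \<le> liminf (\<lambda>n. 1)"
    proof (intro Liminf_mono always_eventually allI)
      fix n
      obtain a' b' where z: "z n = (a', b')" by force
      then have *: "0 < a'" "1 \<le> b'" "p_conv a' b'" "weight_gf p a' b' \<le> 1"
        using zT[rule_format, of n] by auto
      then have "AE x in measure_pmf p. 0 \<le> monomial2 a' b' x"
        by (auto simp: monomial2_def)
      then have "(\<integral>\<^sup>+x. ennreal (monomial2 a' b' x) \<partial>measure_pmf p) = ennreal (weight_gf p a' b')"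
        using * by (simp add: nn_integral_eq_integral weight_gf_eq_integral)
      then show "(\<integral>\<^sup>+x. ennreal (monomial2 (fst (z n)) (snd (z n)) x) \<partial>measure_pmf p) \<le> 1"
        using * by (simp add: z)
    qed
    also have "liminf (\<lambda>n. 1 :: ennreal) = 1"
      by (rule Liminf_const) simp
    finally have le1: "(\<integral>\<^sup>+x. ennreal (monomial2 a b x) \<partial>measure_pmf p) \<le> 1" .
    then have conv: "p_conv a b"
      using nonneg by (intro integrableI_nonneg) (auto intro: le_less_trans)
    then have "ennreal (weight_gf p a b) \<le> 1"
      using le1 nonneg by (simp add: nn_integral_eq_integral weight_gf_eq_integral)
    then show "l \<in> ?T"
      using ab conv by (simp add: l)
  qed
  then have "compact (({?c..1} \<times> {1..1 / ?c}) \<inter> ?T)"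
    by (intro compact_Int_closed compact_Times) auto
  moreover have "({?c..1} \<times> {1..1 / ?c}) \<inter> ?T = ?T"
    using sub by blast
  ultimately show ?thesis
    by metis
qed

text \<open>The maximum of \<open>u_fun p\<close> is the largest second coordinate \<open>B\<close>
  in the compact sublevel set. It exceeds 1 because the drift gives a point at height 1 below level
  1, which convergence beyond 1 allows to be raised. A highest point below level 1 can be moved left
  onto the curve without changing its height.\<close>

lemma alpha_hat_props: "0 < alpha_hat p" "alpha_hat p < 1"
    "1 < u_fun p (alpha_hat p)" "weight_gf p (alpha_hat p) (u_fun p (alpha_hat p)) = 1"
proof -
  let ?T = "{(a, b). 0 < a \<and> a \<le> 1 \<and> 1 \<le> b \<and> p_conv a b \<and> weight_gf p a b \<le> 1}"
  obtain a0 where a0: "0 < a0" "a0 < 1" "weight_gf p a0 1 < 1"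
    using weight_gf_below_1 by blast
  obtain e where e: "1 < e" "p_conv e e"
    using p_conv_beyond_1 by blast
  have conv_e: "p_conv a0 e"
    using p_conv_mono[OF e(2), of a0] a0 e by auto
  obtain w where "w \<in> open_segment 1 e" "weight_gf p a0 w < 1"
    using convex_on_near_less[OF convex_on_weight_gf2[OF conv_e a0(1)], of 1 e 1] a0 e by auto
  then have w: "1 < w" "w < e" "weight_gf p a0 w < 1"
    using e by (auto simp: open_segment_eq_real_ivl)
  then have wT: "(a0, w) \<in> ?T"
    using a0 p_conv_mono2[OF conv_e, of w] by auto
  then obtain m where m: "m \<in> ?T" "\<And>y. y \<in> ?T \<Longrightarrow> snd y \<le> snd m"
    using continuous_attains_sup[OF compact_sublevel, of snd] continuous_on_snd[OF continuous_on_id]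
    by blast
  obtain a1 B where mab: "m = (a1, B)" by force
  have B: "1 < B"
    using m(2)[OF wT] w by (simp add: mab)
  have a1: "0 < a1" "a1 \<le> 1" "p_conv a1 B" "weight_gf p a1 B \<le> 1"
    using m(1) by (auto simp: mab)
  \<comment> \<open>With first argument 1 the transform equals 1 at 1 and, by the second drift, is
    smaller at some \<open>b < 1\<close>; convexity keeps it above 1 beyond 1.\<close>
  have "a1 \<noteq> 1"
  proof
    assume "a1 = 1"
    then have cvx: "convex_on {0<..B} (weight_gf p 1)"
      using a1 by (intro convex_on_weight_gf2) auto
    interpret sw: singular_quadrant_data "swap_w p" "swap_w v" "swap_w h" "swap_w q"
      by (rule swapped)
    obtain b where "0 < b" "b < 1" "weight_gf p 1 b < 1"
      using sw.weight_gf_below_1 by (auto simp: weight_gf_swap)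
    then show False
      using convex_on_mixture_less[OF cvx, of b B 1 1] B a1 \<open>a1 = 1\<close> by (simp add: weight_gf_1_1)
  qed
  then obtain x where x: "0 < x" "x < 1" "weight_gf p x B = 1"
    using weight_gf_root_to_left[of a1 B] a1 B by (cases "weight_gf p a1 B = 1") force+
  then have ux: "u_fun p x = B"
    using B by (intro u_fun_eq) auto
  have le: "u_fun p a \<le> B" if "a \<in> {0..1}" for a
  proof -
    consider "a = 0" | "a = 1" | "0 < a" "a < 1"
      using \<open>a \<in> {0..1}\<close> by force
    then show ?thesis
    proof cases
      case 3
      from this show ?thesis
      proof (cases rule: u_fun_cases)
        case 2
        then show ?thesis
          using m(2)[of "(a, u_fun p a)"] 3 B weight_gf_eq_1_integrable[of p]
          by (cases "1 \<le> u_fun p a") (auto simp: mab)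
      qed (use B in simp)
    qed (use B in \<open>auto simp: u_fun_def\<close>)
  qed
  \<comment> \<open>Once one maximizer is exhibited, the point chosen in \<open>alpha_hat\<close>
    has the same maximal value.\<close>
  have "is_arg_max (u_fun p) (\<lambda>x. x \<in> {0..1}) x"
    using x le ux by (simp add: is_arg_max_linorder)
  then have "is_arg_max (u_fun p) (\<lambda>x. x \<in> {0..1}) (alpha_hat p)"
    unfolding alpha_hat_def arg_max_on_def arg_max_def by (rule someI)
  then have hat: "alpha_hat p \<in> {0..1}" "u_fun p (alpha_hat p) \<ge> B"
    using x ux unfolding is_arg_max_linorder by force+
  then have "alpha_hat p \<noteq> 0" "alpha_hat p \<noteq> 1"
    using B by (auto simp: u_fun_def)
  then show hat01: "0 < alpha_hat p" "alpha_hat p < 1"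
    using hat by auto
  show "1 < u_fun p (alpha_hat p)"
    using hat B by simp
  show "weight_gf p (alpha_hat p) (u_fun p (alpha_hat p)) = 1"
    using hat01 by (cases rule: u_fun_cases) (use hat B in auto)
qed

text \<open>From here on the inverse branch on (0, 1] is simply the root left of the diagonal. Such
  a root cannot exceed \<open>alpha_hat p\<close>: there the height \<open>b\<close> would lie
  between the diagonal and the maximum of \<open>u_fun p\<close>, where the transform is below 1,
  whereas left of the root it exceeds 1.\<close>

lemma u_star_eq:
  assumes "0 < a" "a < b" "b \<le> 1" "weight_gf p a b = 1"
  shows "u_star p b = a"
  unfolding u_star_def the_inv_into_def
proof (rule the_equality)
  have "a \<le> alpha_hat p"
  proof (rule ccontr)
    assume less: "\<not> a \<le> alpha_hat p"
    have "weight_gf p (alpha_hat p) b < 1"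
      using alpha_hat_props less assms weight_gf_eq_1_integrable[of p]
      by (intro weight_gf_below_upper_root[of _ _ "u_fun p (alpha_hat p)"]) auto
    then show False
      using weight_gf_around_root(2)[OF assms, of "alpha_hat p"] alpha_hat_props less by auto
  qed
  then show "a \<in> {0..alpha_hat p} \<and> u_fun p a = b"
    using assms u_fun_eq by auto
next
  fix x
  assume x: "x \<in> {0..alpha_hat p} \<and> u_fun p x = b"
  then have "x \<noteq> 0"
    using assms by (auto simp: u_fun_def)
  then have x01: "0 < x" "x < 1"
    using x alpha_hat_props by auto
  then have "x < b" "weight_gf p x b = 1"
    using x assms by (auto elim: u_fun_cases)
  then show "x = a"
    using weight_gf_around_root[OF assms, of x] x01 by (cases a x rule: linorder_cases) auto
qed

lemma u_star_root:
  assumes "0 < b" "b \<le> 1"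
  shows "0 < u_star p b" "u_star p b < b" "weight_gf p (u_star p b) b = 1"
  using weight_gf_root_exists[OF assms] u_star_eq assms by metis+

lemma v_star_root:
  assumes "0 < a" "a \<le> 1"
  shows "0 < v_star p a" "v_star p a < a" "weight_gf p a (v_star p a) = 1"
proof -
  interpret sw: singular_quadrant_data "swap_w p" "swap_w v" "swap_w h" "swap_w q"
    by (rule swapped)
  show "0 < v_star p a" "v_star p a < a" "weight_gf p a (v_star p a) = 1"
    using sw.u_star_root[OF assms] by (simp_all add: v_star_swap weight_gf_swap)
qed

end

section \<open>The sequences and the coefficients\<close>

text \<open>Only nonnegative indices get a name; the negative ones are these sequences for the
  swapped weights, with the roles of the two exchanged.\<close>

definition a_seq :: "weights \<Rightarrow> nat \<Rightarrow> real" where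
  "a_seq p n = fst (ab_fwd p n)"

definition b_seq :: "weights \<Rightarrow> nat \<Rightarrow> real" where
  "b_seq p n = snd (ab_fwd p n)"

definition contact_factor :: "weights \<Rightarrow> complex \<Rightarrow> real \<Rightarrow> real \<Rightarrow> complex" where
  "contact_factor w z a b = 1 - z * of_real (weight_gf w a b)"

text \<open>\<open>d_fwd p h v z n\<close> is the paper's \<open>d\<^sub>n\<^sub>+\<^sub>1(z)\<close>.\<close>

definition d_fwd :: "weights \<Rightarrow> weights \<Rightarrow> weights \<Rightarrow> complex \<Rightarrow> nat \<Rightarrow> complex" where
  "d_fwd p h v z n = - c_fwd p h v z n *
     (contact_factor v z (a_seq p n) (b_seq p n) / contact_factor v z (a_seq p (Suc n)) (b_seq p n))"

lemma seq_0 [simp]: "a_seq p 0 = 1" "b_seq p 0 = 1"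
  by (simp_all add: a_seq_def b_seq_def)

lemma seq_Suc: "a_seq p (Suc n) = u_star p (b_seq p n)" "b_seq p (Suc n) = v_star p (a_seq p (Suc n))"
  by (simp_all add: a_seq_def b_seq_def Let_def)

lemma alpha_of_nat: "alpha p (int n) = a_seq p n" and beta_of_nat: "beta p (int n) = b_seq p n"
  by (simp_all add: alpha_def beta_def a_seq_def b_seq_def)

lemma factor_of_nat: "factor p w z (int m) (int n) = contact_factor w z (a_seq p m) (b_seq p n)"
  by (simp add: factor_def contact_factor_def alpha_of_nat beta_of_nat)

lemma c_fwd_Suc: "c_fwd p h v z (Suc n) = - d_fwd p h v z n *
    (contact_factor h z (a_seq p (Suc n)) (b_seq p n) / contact_factor h z (a_seq p (Suc n)) (b_seq p (Suc n)))"
  using factor_of_nat[of p v z "Suc n" n] factor_of_nat[of p h z "Suc n" n]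
    factor_of_nat[of p h z "Suc n" "Suc n"]
  by (simp add: Let_def d_fwd_def factor_of_nat add.commute)

lemma contact_factor_bounds:
  assumes "norm z \<le> 1" "0 \<le> weight_gf w a b" "weight_gf w a b \<le> s"
  shows "norm (contact_factor w z a b) \<le> 1 + s" "1 - s \<le> norm (contact_factor w z a b)"
proof -
  have "norm (z * of_real (weight_gf w a b)) \<le> 1 * s"
    using assms unfolding norm_mult by (intro mult_mono) auto
  then show "norm (contact_factor w z a b) \<le> 1 + s" "1 - s \<le> norm (contact_factor w z a b)"
    unfolding contact_factor_def
    using norm_triangle_ineq4[of 1 "z * of_real (weight_gf w a b)"]
      norm_triangle_ineq2[of 1 "z * of_real (weight_gf w a b)"] by simp_all
qed

lemma contact_factor_neq_0:
  assumes "norm z \<le> 1" "0 \<le> weight_gf w a b" "weight_gf w a b < 1"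
  shows "contact_factor w z a b \<noteq> 0"
proof
  assume "contact_factor w z a b = 0"
  then show False
    using contact_factor_bounds(2)[OF assms(1,2) order_refl] assms(3) by simp
qed

lemma norm_ratio_le:
  fixes x y :: complex and s :: real
  assumes "norm x \<le> 1 + s" "1 - s \<le> norm y" "0 \<le> s" "s < 1"
  shows "norm (x / y) \<le> (1 + s) / (1 - s)"
  using assms unfolding norm_divide by (intro frac_le) auto

lemma power_product_le:
  fixes a b c s :: real
  assumes "0 < a" "0 < b" "a \<le> s" "b \<le> s" "s \<le> 1" "a \<le> c" "c \<le> 1" "i \<noteq> 0 \<or> j \<noteq> 0"
  shows "a ^ i * b ^ j \<le> c ^ i / c * s"
proof (cases i)
  case 0
  then obtain m where m: "j = Suc m"
    using assms by (auto simp: gr0_conv_Suc)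
  have "b ^ j \<le> b ^ 1"
    using assms by (intro power_decreasing) (auto simp: m)
  also have "\<dots> \<le> s / c"
    using assms by (simp add: field_simps) (smt (verit) mult_left_le mult.commute)
  finally show ?thesis
    by (simp add: 0)
next
  case (Suc m)
  have "a ^ m * a * b ^ j \<le> c ^ m * s * 1"
    using assms by (intro mult_mono power_mono power_le_one) auto
  then show ?thesis
    using assms by (simp add: Suc mult_ac)
qed

text \<open>A reflection step is nonzero with nonnegative coordinates, so its monomial has at least
  one factor bounded by \<open>s\<close>, and the others are at most 1.\<close>

lemma quadrant_weight_bounds:
  assumes supp: "\<And>k l. k < 0 \<or> l < 0 \<or> (k, l) = (0, 0) \<Longrightarrow> pmf w (k, l) = 0"
    and ab: "0 < a" "a \<le> s" "0 < b" "b \<le> s" "s \<le> 1"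
  shows "integrable (measure_pmf w) (monomial2 a b)" "0 \<le> weight_gf w a b" "weight_gf w a b \<le> s"
proof -
  have le: "0 \<le> monomial2 a b x \<and> monomial2 a b x \<le> s" if "x \<in> set_pmf w" for x
  proof -
    obtain k l where x: "x = (k, l)" by force
    then have "\<not> (k < 0 \<or> l < 0 \<or> (k, l) = (0, 0))"
      using supp[of k l] that by (auto simp: set_pmf_iff)
    then obtain m n where mn: "k = int m" "l = int n" "m \<noteq> 0 \<or> n \<noteq> 0"
      by (metis of_nat_0 nonneg_int_cases not_le)
    show ?thesis
      using power_product_le[of a b s 1 m n] ab mn by (simp add: x)
  qed
  show int: "integrable (measure_pmf w) (monomial2 a b)"
    using le by (intro measure_pmf.integrable_const_bound[where B = s]) (auto simp: AE_measure_pmf_iff)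
  show "0 \<le> weight_gf w a b"
    unfolding weight_gf_eq_integral using le by (intro integral_nonneg_AE) (auto simp: AE_measure_pmf_iff)
  have "measure_pmf.expectation w (monomial2 a b) \<le> measure_pmf.expectation w (\<lambda>_. s)"
    using int le by (intro integral_mono_AE) (auto simp: AE_measure_pmf_iff)
  then show "weight_gf w a b \<le> s"
    by (simp add: weight_gf_eq_integral)
qed

context singular_quadrant_data
begin

lemma v_supp: "k < 0 \<or> l < 0 \<or> (k, l) = (0, 0) \<Longrightarrow> pmf v (k, l) = 0"
  using reflection_support[of v] by simp

lemma h_supp: "k < 0 \<or> l < 0 \<or> (k, l) = (0, 0) \<Longrightarrow> pmf h (k, l) = 0"
  using reflection_support[of h] by simp

text \<open>With second argument 1 the general bound gives only 1. Strictness comes from a step off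
  the vertical axis, which the positive horizontal mean of \<open>v\<close> provides.\<close>

lemma weight_gf_v_less_1:
  assumes a: "0 < a" "a < 1"
  shows "weight_gf v a 1 < 1"
proof -
  have "\<exists>k l. k \<noteq> 0 \<and> pmf v (k, l) \<noteq> 0"
  proof (rule ccontr)
    assume "\<not> ?thesis"
    then have "(\<lambda>(k, l). of_int k * pmf v (k, l)) = (\<lambda>_. 0 :: real)"
      by (auto simp: fun_eq_iff)
    then show False
      using v_means(1) by (simp del: case_prod_conv)
  qed
  then obtain k l where kl: "k \<noteq> 0" "pmf v (k, l) \<noteq> 0" by blast
  have pos: "0 \<le> k" "pmf v (k, l) > 0" if "pmf v (k, l) \<noteq> 0" for k l
    using v_supp[of k l] that by (force simp: pmf_positive set_pmf_iff)+
  note bounds = quadrant_weight_bounds[OF v_supp, of a 1 1]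
  have "pmf v (k, l) * (1 - monomial2 a 1 (k, l)) \<le> measure_pmf.expectation v (\<lambda>x. 1 - monomial2 a 1 x)"
  proof (rule pmf_expectation_ge_single)
    have le: "a powi k \<le> 1" if "0 \<le> k" for k
      using a that by (simp add: power_int_def power_le_one)
    show "0 \<le> 1 - monomial2 a 1 x" if "x \<in> set_pmf v" for x
      using pos(1)[of "fst x" "snd x"] that le[of "fst x"] by (cases x) (simp add: set_pmf_iff)
    show "0 \<le> 1 - monomial2 a 1 (k, l)"
      using pos(1)[OF kl(2)] le[of k] by simp
  qed (use bounds(1) a in simp)
  moreover have "a powi k < 1"
    using a pos(1)[OF kl(2)] kl(1) by (simp add: power_int_def power_less_one_iff)
  then have "0 < pmf v (k, l) * (1 - monomial2 a 1 (k, l))"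
    using pos(2)[OF kl(2)] by simp
  ultimately show ?thesis
    using bounds(1) a by (simp add: weight_gf_eq_integral)
qed

section \<open>Interlacing and geometric decay of the sequences\<close>

lemma seq_pos_le_1: "0 < a_seq p n \<and> a_seq p n \<le> 1 \<and> 0 < b_seq p n \<and> b_seq p n \<le> 1"
proof (induction n)
  case (Suc n)
  then show ?case
    using u_star_root[of "b_seq p n"] v_star_root[of "a_seq p (Suc n)"]
    by (auto simp: seq_Suc)
qed simp

lemma seq_bounds: "0 < a_seq p n" "a_seq p n \<le> 1" "0 < b_seq p n" "b_seq p n \<le> 1"
  using seq_pos_le_1[of n] by auto

lemma seq_root: "a_seq p (Suc n) < b_seq p n" "weight_gf p (a_seq p (Suc n)) (b_seq p n) = 1"
  using u_star_root[of "b_seq p n"] seq_bounds[of n] by (simp_all add: seq_Suc)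

lemma seq_root2: "b_seq p (Suc n) < a_seq p (Suc n)" "weight_gf p (a_seq p (Suc n)) (b_seq p (Suc n)) = 1"
  using v_star_root[of "a_seq p (Suc n)"] seq_bounds[of "Suc n"] by (simp_all add: seq_Suc(2))

lemma b_seq_le_a_seq: "b_seq p n \<le> a_seq p n"
  using seq_root2(1) by (cases n) (auto intro: less_imp_le)

lemma a_seq_Suc_less: "a_seq p (Suc n) < a_seq p n"
  using seq_root(1)[of n] b_seq_le_a_seq[of n] by simp

lemma decseq_a_seq: "decseq (a_seq p)"
  using a_seq_Suc_less by (intro decseq_SucI) (simp add: less_imp_le)

lemma a_seq_Suc_le_a_seq_1: "a_seq p (Suc n) \<le> a_seq p 1"
  using decseq_a_seq by (auto simp: decseq_def)

lemma a_seq_Suc_less_1: "a_seq p (Suc n) < 1"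
  using seq_root(1)[of n] seq_bounds(4)[of n] by simp

lemma weight_gf_diagonal_mono:
  assumes "0 < a" "a \<le> c" "c \<le> 1"
  shows "weight_gf p a a \<le> weight_gf p c c"
  unfolding weight_gf_eq_integral
proof (rule integral_mono_AE)
  show "p_conv a a" "p_conv c c"
    using assms by (auto intro!: p_conv_le_1)
  show "AE x in measure_pmf p. monomial2 a a x \<le> monomial2 c c x"
    unfolding AE_measure_pmf_iff
  proof
    fix x assume "x \<in> set_pmf p"
    then obtain k l where x: "x = (k, l)" "(k, l) \<in> set_pmf p"
      by (cases x) auto
    then obtain n where n: "k + l = int n"
      using p_set(3) zero_le_imp_eq_int by blast
    have "y powi k * y powi l = y ^ n" if "y > 0" for y :: real
      using that n by (simp flip: power_int_add)
    then show "monomial2 a a x \<le> monomial2 c c x"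
      using assms by (simp add: x power_mono)
  qed
qed

text \<open>By monotonicity along the diagonal this bounds the diagonal values at all elements of
  index at least 1. Index 0 is left out because its diagonal value is 1.\<close>

definition contraction :: real where
  "contraction = weight_gf p (a_seq p 1) (a_seq p 1)"

text \<open>At a point \<open>(a, b)\<close> of the curve left of the diagonal,
  \<open>p_conv_mono\<close> bounds the value 1 by \<open>b / a\<close> times the diagonal value at
  \<open>b\<close>. So \<open>a / b\<close> is at most a diagonal value.\<close>

lemma contraction_bounds: "contraction < 1" "0 < contraction" "a_seq p (Suc (Suc n)) \<le> contraction * b_seq p (Suc n)"
proof -
  show "contraction < 1"
    unfolding contraction_def using seq_bounds(1)[of 1] a_seq_Suc_less_1[of 0]
    by (intro weight_gf_diagonal) auto
  show le: "a_seq p (Suc (Suc n)) \<le> contraction * b_seq p (Suc n)" for n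
  proof -
    let ?a = "a_seq p (Suc (Suc n))" and ?b = "b_seq p (Suc n)"
    have ab: "0 < ?a" "0 < ?b" "?a \<le> ?b" "?b \<le> 1"
      using seq_bounds[of "Suc n"] seq_bounds[of "Suc (Suc n)"] seq_root(1)[of "Suc n"] by auto
    then have "p_conv ?b ?b"
      by (intro p_conv_le_1)
    then have "1 \<le> (?b / ?a) * weight_gf p ?b ?b"
      using p_conv_mono(2)[of ?b ?b ?a] ab seq_root(2)[of "Suc n"] by simp
    then have "?a \<le> weight_gf p ?b ?b * ?b"
      using ab by (simp add: field_simps)
    also have "weight_gf p ?b ?b \<le> contraction"
      unfolding contraction_def
      using seq_root2(1)[of n] a_seq_Suc_le_a_seq_1[of n] ab seq_bounds(2)[of 1]
      by (intro weight_gf_diagonal_mono) auto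
    finally show ?thesis
      using ab by simp
  qed
  have "0 < contraction * b_seq p (Suc 0)"
    using le[of 0] seq_bounds(1)[of "Suc (Suc 0)"] by simp
  then show "0 < contraction"
    using seq_bounds(3)[of "Suc 0"] by (simp add: zero_less_mult_iff)
qed

lemma a_seq_contraction: "a_seq p (Suc (Suc n)) \<le> contraction * a_seq p (Suc n)"
proof -
  have "a_seq p (Suc (Suc n)) \<le> contraction * b_seq p (Suc n)"
    by (rule contraction_bounds)
  also have "\<dots> \<le> contraction * a_seq p (Suc n)"
    using b_seq_le_a_seq contraction_bounds by simp
  finally show ?thesis .
qed

lemma a_seq_tendsto_0: "a_seq p \<longlonglongrightarrow> 0"
proof -
  have le: "a_seq p (Suc n) \<le> contraction ^ n" for n
  proof (induction n)
    case 0
    then show ?case using seq_bounds(2)[of 1] by simp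
  next
    case (Suc n)
    have "a_seq p (Suc (Suc n)) \<le> contraction * a_seq p (Suc n)"
      by (rule a_seq_contraction)
    also have "\<dots> \<le> contraction * contraction ^ n"
      using Suc contraction_bounds by simp
    finally show ?case by simp
  qed
  have lim: "(\<lambda>n. contraction ^ n) \<longlonglongrightarrow> 0"
    using contraction_bounds by (intro LIMSEQ_power_zero) simp
  have "(\<lambda>n. a_seq p (Suc n)) \<longlonglongrightarrow> 0"
    by (rule tendsto_sandwich[OF _ _ tendsto_const lim])
      (simp_all add: le less_imp_le[OF seq_bounds(1)])
  then show ?thesis
    by (rule LIMSEQ_imp_Suc)
qed

lemma v_gf_bounds: "0 \<le> weight_gf v (a_seq p n) (b_seq p n)" "weight_gf v (a_seq p n) (b_seq p n) \<le> a_seq p n"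
  "0 \<le> weight_gf v (a_seq p (Suc n)) (b_seq p n)" "weight_gf v (a_seq p (Suc n)) (b_seq p n) \<le> a_seq p n"
  "weight_gf v (a_seq p (Suc n)) (b_seq p n) < 1"
proof -
  note s = seq_bounds[of n] seq_bounds[of "Suc n"] b_seq_le_a_seq[of n] a_seq_Suc_less[of n]
  show "0 \<le> weight_gf v (a_seq p n) (b_seq p n)" "weight_gf v (a_seq p n) (b_seq p n) \<le> a_seq p n"
    "0 \<le> weight_gf v (a_seq p (Suc n)) (b_seq p n)"
    using s by (auto intro!: quadrant_weight_bounds(2,3)[OF v_supp, where s = "a_seq p n"])
  show le: "weight_gf v (a_seq p (Suc n)) (b_seq p n) \<le> a_seq p n"
    using s by (auto intro!: quadrant_weight_bounds(3)[OF v_supp, where s = "a_seq p n"])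
  \<comment> \<open>At index 0 the previous bound is only 1, and strictness comes from the
    reflection off the axis.\<close>
  show "weight_gf v (a_seq p (Suc n)) (b_seq p n) < 1"
    using weight_gf_v_less_1[of "a_seq p (Suc n)"] le s a_seq_Suc_less_1[of n] a_seq_Suc_less_1[of "n - 1"]
    by (cases n) auto
qed

lemma h_gf_bounds: "0 \<le> weight_gf h (a_seq p (Suc n)) (b_seq p n)" "weight_gf h (a_seq p (Suc n)) (b_seq p n) \<le> b_seq p n"
  "0 \<le> weight_gf h (a_seq p (Suc n)) (b_seq p (Suc n))" "weight_gf h (a_seq p (Suc n)) (b_seq p (Suc n)) \<le> a_seq p (Suc n)"
proof -
  note s = seq_bounds[of n] seq_bounds[of "Suc n"] b_seq_le_a_seq[of "Suc n"] seq_root(1)[of n]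
  show "0 \<le> weight_gf h (a_seq p (Suc n)) (b_seq p n)" "weight_gf h (a_seq p (Suc n)) (b_seq p n) \<le> b_seq p n"
    using s by (auto intro!: quadrant_weight_bounds(2,3)[OF h_supp, where s = "b_seq p n"])
  show "0 \<le> weight_gf h (a_seq p (Suc n)) (b_seq p (Suc n))"
    "weight_gf h (a_seq p (Suc n)) (b_seq p (Suc n)) \<le> a_seq p (Suc n)"
    using s by (auto intro!: quadrant_weight_bounds(2,3)[OF h_supp, where s = "a_seq p (Suc n)"])
qed

section \<open>Growth of the coefficients and absolute convergence\<close>

lemma contact_factor_nonzero:
  assumes "norm z \<le> 1"
  shows "contact_factor v z (a_seq p (Suc n)) (b_seq p n) \<noteq> 0"
    "contact_factor h z (a_seq p (Suc n)) (b_seq p (Suc n)) \<noteq> 0"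
proof -
  show "contact_factor v z (a_seq p (Suc n)) (b_seq p n) \<noteq> 0"
    using assms v_gf_bounds(3,5) by (rule contact_factor_neq_0)
  have "weight_gf h (a_seq p (Suc n)) (b_seq p (Suc n)) < 1"
    using h_gf_bounds(4) a_seq_Suc_less_1 by (rule le_less_trans)
  with assms h_gf_bounds(3) show "contact_factor h z (a_seq p (Suc n)) (b_seq p (Suc n)) \<noteq> 0"
    by (rule contact_factor_neq_0)
qed

text \<open>Indices start at 1 because \<open>1 - a_seq p 0\<close> is 0.\<close>

lemma d_fwd_le:
  assumes "norm z \<le> 1"
  shows "norm (d_fwd p h v z (Suc n)) \<le>
    norm (c_fwd p h v z (Suc n)) * ((1 + a_seq p (Suc n)) / (1 - a_seq p (Suc n)))"
  unfolding d_fwd_def norm_mult norm_minus_cancel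
  using assms seq_bounds(1)[of "Suc n"] a_seq_Suc_less_1[of n] v_gf_bounds[of "Suc n"]
  by (intro mult_left_mono norm_ratio_le contact_factor_bounds) auto

lemma c_fwd_le:
  assumes z: "norm z \<le> 1"
  shows "norm (c_fwd p h v z (Suc (Suc n))) \<le>
    norm (c_fwd p h v z (Suc n)) * ((1 + a_seq p (Suc n)) / (1 - a_seq p (Suc n)))\<^sup>2"
proof -
  let ?r = "(1 + a_seq p (Suc n)) / (1 - a_seq p (Suc n))"
  have "norm (contact_factor h z (a_seq p (Suc (Suc n))) (b_seq p (Suc n)) /
      contact_factor h z (a_seq p (Suc (Suc n))) (b_seq p (Suc (Suc n)))) \<le> ?r"
    using z seq_bounds(1)[of "Suc n"] a_seq_Suc_less_1[of n] h_gf_bounds[of "Suc n"]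
      b_seq_le_a_seq[of "Suc n"] a_seq_Suc_less[of "Suc n"]
    by (intro norm_ratio_le contact_factor_bounds) auto
  then have "norm (c_fwd p h v z (Suc (Suc n))) \<le> norm (d_fwd p h v z (Suc n)) * ?r"
    unfolding c_fwd_Suc[of p h v z "Suc n"] norm_mult norm_minus_cancel by (intro mult_left_mono) auto
  also have "\<dots> \<le> (norm (c_fwd p h v z (Suc n)) * ?r) * ?r"
    using seq_bounds(1)[of "Suc n"] a_seq_Suc_less_1[of n]
    by (intro mult_right_mono d_fwd_le z) auto
  finally show ?thesis
    by (simp add: power2_eq_square mult.assoc)
qed

lemma ratio_tendsto_1: "(\<lambda>n. (1 + a_seq p (Suc n)) / (1 - a_seq p (Suc n))) \<longlonglongrightarrow> 1"
proof -
  have "(\<lambda>n. (1 + a_seq p (Suc n)) / (1 - a_seq p (Suc n))) \<longlonglongrightarrow> (1 + 0) / (1 - 0)"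
    by (intro tendsto_intros LIMSEQ_Suc a_seq_tendsto_0) simp
  then show ?thesis by simp
qed

text \<open>The ratios of the coefficients have bounds tending to 1, while the sequence shrinks by
  \<open>contraction\<close>. So the ratio test works with the midpoint \<open>q\<close> of
  \<open>contraction\<close> and 1.\<close>

lemma summable_c_fwd:
  assumes z: "norm z \<le> 1"
  shows "summable (\<lambda>n. norm (c_fwd p h v z (Suc n)) * a_seq p (Suc n))"
proof -
  let ?r = "\<lambda>n. (1 + a_seq p (Suc n)) / (1 - a_seq p (Suc n))"
  let ?f = "\<lambda>n. norm (c_fwd p h v z (Suc n)) * a_seq p (Suc n)"
  define q where "q = (1 + contraction) / 2"
  have q: "contraction < q" "q < 1"
    using contraction_bounds by (auto simp: q_def)
  have "(\<lambda>n. (?r n)\<^sup>2 * contraction) \<longlonglongrightarrow> 1\<^sup>2 * contraction"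
    by (intro tendsto_intros ratio_tendsto_1)
  then have "\<forall>\<^sub>F n in sequentially. (?r n)\<^sup>2 * contraction < q"
    using q by (intro order_tendstoD(2)) auto
  then obtain N where N: "\<And>n. n \<ge> N \<Longrightarrow> (?r n)\<^sup>2 * contraction < q"
    unfolding eventually_sequentially by blast
  show ?thesis
  proof (rule summable_ratio_test[OF q(2)])
    fix n assume n: "N \<le> n"
    have pos: "0 \<le> a_seq p m" for m
      using seq_bounds(1)[of m] by simp
    have "?f (Suc n) \<le> (norm (c_fwd p h v z (Suc n)) * (?r n)\<^sup>2) * (contraction * a_seq p (Suc n))"
      using c_fwd_le[OF z, of n] a_seq_contraction[of n] pos contraction_bounds
      by (intro mult_mono) auto
    also have "\<dots> = ((?r n)\<^sup>2 * contraction) * ?f n"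
      by (simp only: mult_ac)
    also have "\<dots> \<le> q * ?f n"
      using N[OF n] pos by (intro mult_right_mono) auto
    finally show "norm (?f (Suc n)) \<le> q * norm (?f n)"
      using pos by (simp add: abs_mult)
  qed
qed

text \<open>The weight is \<open>b_seq p n\<close> because it bounds both bases of the monomial that
  this coefficient multiplies.\<close>

lemma summable_d_fwd:
  assumes z: "norm z \<le> 1"
  shows "summable (\<lambda>n. norm (d_fwd p h v z n) * b_seq p n)"
proof -
  let ?r = "\<lambda>n. (1 + a_seq p (Suc n)) / (1 - a_seq p (Suc n))"
  have "\<forall>\<^sub>F n in sequentially. ?r n < 2"
    using ratio_tendsto_1 by (rule order_tendstoD) simp
  then have "\<forall>\<^sub>F n in sequentially. norm (norm (d_fwd p h v z (Suc n)) * b_seq p (Suc n)) \<le>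
      2 * (norm (c_fwd p h v z (Suc n)) * a_seq p (Suc n))"
  proof eventually_elim
    fix n
    assume r: "?r n < 2"
    have "norm (d_fwd p h v z (Suc n)) \<le> norm (c_fwd p h v z (Suc n)) * ?r n"
      by (rule d_fwd_le[OF z])
    also have "\<dots> \<le> norm (c_fwd p h v z (Suc n)) * 2"
      using r by (intro mult_left_mono) auto
    finally have "norm (d_fwd p h v z (Suc n)) * b_seq p (Suc n) \<le> norm (c_fwd p h v z (Suc n)) * 2 * a_seq p (Suc n)"
      using b_seq_le_a_seq seq_bounds(3)[of "Suc n"] by (intro mult_mono) auto
    then show "norm (norm (d_fwd p h v z (Suc n)) * b_seq p (Suc n)) \<le>
        2 * (norm (c_fwd p h v z (Suc n)) * a_seq p (Suc n))"
      using seq_bounds(3)[of "Suc n"] by (simp add: abs_mult)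
  qed
  then have "summable (\<lambda>n. norm (d_fwd p h v z (Suc n)) * b_seq p (Suc n))"
    by (rule summable_comparison_test_ev) (intro summable_mult summable_c_fwd z)
  then show ?thesis
    by (subst (asm) summable_Suc_iff)
qed

end

section \<open>The half series\<close>

declare c_fwd.simps(2) [simp del]

definition geo :: "real \<Rightarrow> real \<Rightarrow> nat \<times> nat \<Rightarrow> real" where
  "geo a b s = a ^ fst s * b ^ snd s"

definition jump :: "nat \<times> nat \<Rightarrow> int \<times> int \<Rightarrow> nat \<times> nat" where
  "jump s x = (nat (int (fst s) + fst x), nat (int (snd s) + snd x))"

text \<open>The sign conditions keep \<open>nat\<close> in \<open>jump\<close> from truncating;
  excluding the origin as a target keeps the walk where the series converge.\<close>

definition admissible :: "weights \<Rightarrow> nat \<times> nat \<Rightarrow> bool" where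
  "admissible w s \<longleftrightarrow> (\<forall>x\<in>set_pmf w. 0 \<le> int (fst s) + fst x \<and> 0 \<le> int (snd s) + snd x \<and> jump s x \<noteq> (0, 0))"

lemma geo_nonneg: "0 \<le> a \<Longrightarrow> 0 \<le> b \<Longrightarrow> 0 \<le> geo a b s"
  by (simp add: geo_def)

lemma geo_jump:
  assumes "0 < a" "0 < b" "0 \<le> int (fst s) + fst x" "0 \<le> int (snd s) + snd x"
  shows "geo a b (jump s x) = geo a b s * monomial2 a b x"
proof -
  have *: "c ^ nat (int i + k) = c ^ i * c powi k" if "0 < c" "0 \<le> int i + k" for c :: real and i k
  proof -
    have "c ^ nat (int i + k) = c powi (int i + k)"
      using that by (simp add: power_int_def)
    also have "\<dots> = c ^ i * c powi k"
      using that by (simp add: power_int_add)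
    finally show ?thesis .
  qed
  show ?thesis
    using assms by (cases x) (simp add: geo_def jump_def *)
qed

text \<open>Monomials are eigenfunctions of a translation-invariant step.\<close>

lemma geo_expectation:
  assumes "0 < a" "0 < b" "admissible w s" "integrable (measure_pmf w) (monomial2 a b)"
  shows "integrable (measure_pmf w) (\<lambda>x. geo a b (jump s x))"
    and "measure_pmf.expectation w (\<lambda>x. geo a b (jump s x)) = geo a b s * weight_gf w a b"
proof -
  have eq: "AE x in measure_pmf w. geo a b (jump s x) = geo a b s * monomial2 a b x"
    using assms(3) geo_jump[OF assms(1,2)] by (auto simp: AE_measure_pmf_iff admissible_def)
  show "integrable (measure_pmf w) (\<lambda>x. geo a b (jump s x))"
    using assms(4) by (subst integrable_cong_AE[OF _ _ eq]) auto
  show "measure_pmf.expectation w (\<lambda>x. geo a b (jump s x)) = geo a b s * weight_gf w a b"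
    by (subst integral_cong_AE[OF _ _ eq]) (auto simp: weight_gf_eq_integral)
qed

text \<open>As the transforms are at most 1, the expected norms after a step are dominated by the
  norms at the starting state \<open>s\<close>. Summability at the other states makes the series
  after the step meaningful.\<close>

lemma geo_series_expectation:
  fixes u :: "nat \<Rightarrow> complex" and a b :: "nat \<Rightarrow> real"
  assumes pos: "\<And>n. 0 < a n" "\<And>n. 0 < b n" and adm: "admissible w s"
    and conv: "\<And>n. integrable (measure_pmf w) (monomial2 (a n) (b n))"
    and gf: "\<And>n. 0 \<le> weight_gf w (a n) (b n)" "\<And>n. weight_gf w (a n) (b n) \<le> 1"
    and summ: "\<And>t. t \<noteq> (0, 0) \<Longrightarrow> summable (\<lambda>n. norm (u n) * geo (a n) (b n) t)" and s: "s \<noteq> (0, 0)"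
  shows "integrable (measure_pmf w) (\<lambda>x. \<Sum>n. u n * of_real (geo (a n) (b n) (jump s x)))"
    and "(\<lambda>n. u n * of_real (geo (a n) (b n) s * weight_gf w (a n) (b n))) sums
      measure_pmf.expectation w (\<lambda>x. \<Sum>n. u n * of_real (geo (a n) (b n) (jump s x)))"
proof -
  let ?f = "\<lambda>n x. u n * of_real (geo (a n) (b n) (jump s x)) :: complex"
  have geo0: "0 \<le> geo (a n) (b n) t" for n t
    using pos by (simp add: geo_nonneg less_imp_le)
  have int: "integrable (measure_pmf w) (\<lambda>x. geo (a n) (b n) (jump s x))"
    and exp: "measure_pmf.expectation w (\<lambda>x. geo (a n) (b n) (jump s x)) = geo (a n) (b n) s * weight_gf w (a n) (b n)" for n
    using geo_expectation[OF pos(1) pos(2) adm conv] by auto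
  have intf: "integrable (measure_pmf w) (?f n)" for n
    by (intro integrable_mult_right integrable_of_real int)
  have norm: "norm (?f n x) = norm (u n) * geo (a n) (b n) (jump s x)" for n x
    using geo0 by (simp add: norm_mult)
  have AE: "AE x in measure_pmf w. summable (\<lambda>n. norm (?f n x))"
    using adm summ unfolding norm by (auto simp: AE_measure_pmf_iff admissible_def)
  have normint: "measure_pmf.expectation w (\<lambda>x. norm (?f n x)) = norm (u n) * (geo (a n) (b n) s * weight_gf w (a n) (b n))" for n
    unfolding norm by (simp add: exp)
  have sum: "summable (\<lambda>n. measure_pmf.expectation w (\<lambda>x. norm (?f n x)))"
    unfolding normint
  proof (rule summable_comparison_test'[OF summ[OF s]])
    fix n :: nat
    have "norm (u n) * (geo (a n) (b n) s * weight_gf w (a n) (b n)) \<le> norm (u n) * (geo (a n) (b n) s * 1)"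
      using geo0 gf by (intro mult_left_mono) auto
    then show "norm (norm (u n) * (geo (a n) (b n) s * weight_gf w (a n) (b n))) \<le> norm (u n) * geo (a n) (b n) s"
      using geo0 gf by simp
  qed
  show "integrable (measure_pmf w) (\<lambda>x. \<Sum>n. ?f n x)"
    by (rule integrable_suminf[OF intf AE sum])
  have "(\<lambda>n. measure_pmf.expectation w (?f n)) sums measure_pmf.expectation w (\<lambda>x. \<Sum>n. ?f n x)"
    by (rule sums_integral[OF intf AE sum])
  moreover have "measure_pmf.expectation w (?f n) = u n * of_real (geo (a n) (b n) s * weight_gf w (a n) (b n))" for n
    by (simp add: exp flip: of_real_mult)
  ultimately show "(\<lambda>n. u n * of_real (geo (a n) (b n) s * weight_gf w (a n) (b n))) sums
      measure_pmf.expectation w (\<lambda>x. \<Sum>n. ?f n x)"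
    by (simp only:)
qed

text \<open>The monomials come in pairs with the common first base \<open>a_seq p (Suc n)\<close>.
  The constant monomial is kept apart, since it would otherwise occur in both halves.\<close>

definition half_series :: "weights \<Rightarrow> weights \<Rightarrow> weights \<Rightarrow> complex \<Rightarrow> nat \<times> nat \<Rightarrow> complex" where
  "half_series p h v z s =
     (\<Sum>n. d_fwd p h v z n * of_real (geo (a_seq p (Suc n)) (b_seq p n) s)) +
     (\<Sum>n. c_fwd p h v z (Suc n) * of_real (geo (a_seq p (Suc n)) (b_seq p (Suc n)) s))"

context singular_quadrant_data
begin

lemma half_series_terms_le:
  assumes "s \<noteq> (0, 0)"
  shows "norm (d_fwd p h v z n) * geo (a_seq p (Suc n)) (b_seq p n) s \<le>
      a_seq p 1 ^ fst s / a_seq p 1 * (norm (d_fwd p h v z n) * b_seq p n)"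
    and "norm (c_fwd p h v z (Suc n)) * geo (a_seq p (Suc n)) (b_seq p (Suc n)) s \<le>
      a_seq p 1 ^ fst s / a_seq p 1 * (norm (c_fwd p h v z (Suc n)) * a_seq p (Suc n))"
proof -
  note bounds = seq_bounds[of n] seq_bounds[of "Suc n"] a_seq_Suc_le_a_seq_1[of n] seq_bounds(2)[of 1]
    seq_root(1)[of n] seq_root2(1)[of n]
  have nz: "fst s \<noteq> 0 \<or> snd s \<noteq> 0"
    using assms by (cases s) auto
  have "geo (a_seq p (Suc n)) (b_seq p n) s \<le> a_seq p 1 ^ fst s / a_seq p 1 * b_seq p n"
    unfolding geo_def using bounds nz by (intro power_product_le) auto
  from mult_left_mono[OF this norm_ge_zero[of "d_fwd p h v z n"]]
  show "norm (d_fwd p h v z n) * geo (a_seq p (Suc n)) (b_seq p n) s \<le>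
      a_seq p 1 ^ fst s / a_seq p 1 * (norm (d_fwd p h v z n) * b_seq p n)"
    by (simp only: mult_ac)
  have "geo (a_seq p (Suc n)) (b_seq p (Suc n)) s \<le> a_seq p 1 ^ fst s / a_seq p 1 * a_seq p (Suc n)"
    unfolding geo_def using bounds nz by (intro power_product_le) auto
  from mult_left_mono[OF this norm_ge_zero[of "c_fwd p h v z (Suc n)"]]
  show "norm (c_fwd p h v z (Suc n)) * geo (a_seq p (Suc n)) (b_seq p (Suc n)) s \<le>
      a_seq p 1 ^ fst s / a_seq p 1 * (norm (c_fwd p h v z (Suc n)) * a_seq p (Suc n))"
    by (simp only: mult_ac)
qed

lemma geo_seq_nonneg: "0 \<le> geo (a_seq p m) (b_seq p n) s"
  using seq_bounds[of m] seq_bounds[of n] by (simp add: geo_nonneg)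

lemma admissible_p: "admissible p (Suc i, Suc j)"
  unfolding admissible_def
proof
  fix x assume "x \<in> set_pmf p"
  then show "0 \<le> int (fst (Suc i, Suc j)) + fst x \<and> 0 \<le> int (snd (Suc i, Suc j)) + snd x \<and> jump (Suc i, Suc j) x \<noteq> (0, 0)"
    using p_set[of "fst x" "snd x"] by (auto simp: jump_def)
qed

lemma admissible_quadrant:
  assumes "\<And>k l. k < 0 \<or> l < 0 \<or> (k, l) = (0, 0) \<Longrightarrow> pmf w (k, l) = 0"
  shows "admissible w s"
  unfolding admissible_def
proof
  fix x assume "x \<in> set_pmf w"
  then have "\<not> (fst x < 0 \<or> snd x < 0 \<or> (fst x, snd x) = (0, 0))"
    using assms(1)[of "fst x" "snd x"] by (metis prod.collapse set_pmf_iff)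
  then show "0 \<le> int (fst s) + fst x \<and> 0 \<le> int (snd s) + snd x \<and> jump s x \<noteq> (0, 0)"
    by (cases x) (auto simp: jump_def)
qed

context
  fixes z :: complex
  assumes z: "norm z \<le> 1"
begin

lemma half_series_summable:
  assumes "s \<noteq> (0, 0)"
  shows "summable (\<lambda>n. norm (d_fwd p h v z n) * geo (a_seq p (Suc n)) (b_seq p n) s)"
    and "summable (\<lambda>n. norm (c_fwd p h v z (Suc n)) * geo (a_seq p (Suc n)) (b_seq p (Suc n)) s)"
proof -
  show "summable (\<lambda>n. norm (d_fwd p h v z n) * geo (a_seq p (Suc n)) (b_seq p n) s)"
    by (rule summable_comparison_test'[OF summable_mult[OF summable_d_fwd[OF z], of "a_seq p 1 ^ fst s / a_seq p 1"]])
      (simp only: real_norm_def abs_of_nonneg[OF mult_nonneg_nonneg[OF norm_ge_zero geo_seq_nonneg]]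
        half_series_terms_le(1)[OF assms])
  show "summable (\<lambda>n. norm (c_fwd p h v z (Suc n)) * geo (a_seq p (Suc n)) (b_seq p (Suc n)) s)"
    by (rule summable_comparison_test'[OF summable_mult[OF summable_c_fwd[OF z], of "a_seq p 1 ^ fst s / a_seq p 1"]])
      (simp only: real_norm_def abs_of_nonneg[OF mult_nonneg_nonneg[OF norm_ge_zero geo_seq_nonneg]]
        half_series_terms_le(2)[OF assms])
qed

lemma half_series_norm_summable:
  assumes "s \<noteq> (0, 0)"
  shows "summable (\<lambda>n. norm (d_fwd p h v z n * of_real (geo (a_seq p (Suc n)) (b_seq p n) s)))"
    and "summable (\<lambda>n. norm (c_fwd p h v z (Suc n) * of_real (geo (a_seq p (Suc n)) (b_seq p (Suc n)) s)))"
  using half_series_summable[OF assms]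
  by (simp_all only: norm_mult norm_of_real abs_of_nonneg[OF geo_seq_nonneg])

lemma half_series_bound:
  obtains C where "0 \<le> C" "\<And>s. s \<noteq> (0, 0) \<Longrightarrow> norm (half_series p h v z s) \<le> C * a_seq p 1 ^ fst s"
proof
  let ?D = "\<lambda>n. norm (d_fwd p h v z n) * b_seq p n"
  let ?C = "\<lambda>n. norm (c_fwd p h v z (Suc n)) * a_seq p (Suc n)"
  let ?B = "(suminf ?D + suminf ?C) / a_seq p 1"
  show "0 \<le> ?B"
    using seq_bounds by (intro divide_nonneg_pos add_nonneg_nonneg suminf_nonneg summable_d_fwd summable_c_fwd z)
      (simp_all add: less_imp_le)
  fix s :: "nat \<times> nat"
  assume s: "s \<noteq> (0, 0)"
  let ?k = "a_seq p 1 ^ fst s / a_seq p 1"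
  have "norm (\<Sum>n. d_fwd p h v z n * of_real (geo (a_seq p (Suc n)) (b_seq p n) s)) \<le> (\<Sum>n. ?k * ?D n)"
    by (rule norm_suminf_le[OF _ summable_mult[OF summable_d_fwd[OF z]]])
      (simp only: norm_mult norm_of_real abs_of_nonneg[OF geo_seq_nonneg] half_series_terms_le(1)[OF s])
  moreover have "norm (\<Sum>n. c_fwd p h v z (Suc n) * of_real (geo (a_seq p (Suc n)) (b_seq p (Suc n)) s)) \<le> (\<Sum>n. ?k * ?C n)"
    by (rule norm_suminf_le[OF _ summable_mult[OF summable_c_fwd[OF z]]])
      (simp only: norm_mult norm_of_real abs_of_nonneg[OF geo_seq_nonneg] half_series_terms_le(2)[OF s])
  ultimately have "norm (half_series p h v z s) \<le> ?k * suminf ?D + ?k * suminf ?C"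
    unfolding half_series_def
    by (intro norm_triangle_le) (simp only: suminf_mult[OF summable_d_fwd[OF z]] suminf_mult[OF summable_c_fwd[OF z]])
  also have "\<dots> = ?B * a_seq p 1 ^ fst s"
  proof -
    have "u / t * x + u / t * y = (x + y) / t * u" for u t x y :: real
      by (simp add: add_divide_distrib distrib_left mult.commute)
    then show ?thesis .
  qed
  finally show "norm (half_series p h v z s) \<le> ?B * a_seq p 1 ^ fst s" .
qed

text \<open>The identity minus \<open>y\<close> times the transition multiplies each monomial by its
  contact factor. The parameter \<open>y\<close> differs from \<open>z\<close> in the interior,
  where a step carries weight 1 although the coefficients depend on \<open>z\<close>.\<close>

lemma half_series_residual:
  assumes adm: "admissible w s" and s: "s \<noteq> (0, 0)"
    and D: "\<And>n. integrable (measure_pmf w) (monomial2 (a_seq p (Suc n)) (b_seq p n))"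
      "\<And>n. 0 \<le> weight_gf w (a_seq p (Suc n)) (b_seq p n)" "\<And>n. weight_gf w (a_seq p (Suc n)) (b_seq p n) \<le> 1"
    and C: "\<And>n. integrable (measure_pmf w) (monomial2 (a_seq p (Suc n)) (b_seq p (Suc n)))"
      "\<And>n. 0 \<le> weight_gf w (a_seq p (Suc n)) (b_seq p (Suc n))"
      "\<And>n. weight_gf w (a_seq p (Suc n)) (b_seq p (Suc n)) \<le> 1"
  shows "integrable (measure_pmf w) (\<lambda>x. half_series p h v z (jump s x))"
    and "(\<lambda>n. d_fwd p h v z n * contact_factor w y (a_seq p (Suc n)) (b_seq p n) * of_real (geo (a_seq p (Suc n)) (b_seq p n) s)
          + c_fwd p h v z (Suc n) * contact_factor w y (a_seq p (Suc n)) (b_seq p (Suc n)) * of_real (geo (a_seq p (Suc n)) (b_seq p (Suc n)) s))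
      sums (half_series p h v z s - y * measure_pmf.expectation w (\<lambda>x. half_series p h v z (jump s x)))"
proof -
  let ?a = "\<lambda>n. a_seq p (Suc n)" and ?b = "b_seq p" and ?b' = "\<lambda>n. b_seq p (Suc n)"
  let ?d = "d_fwd p h v z" and ?c = "\<lambda>n. c_fwd p h v z (Suc n)"
  let ?SD = "\<lambda>s. \<Sum>n. ?d n * of_real (geo (?a n) (?b n) s)"
  let ?SC = "\<lambda>s. \<Sum>n. ?c n * of_real (geo (?a n) (?b' n) s)"
  note ED = geo_series_expectation[of ?a ?b w s ?d, OF seq_bounds(1) seq_bounds(3) adm D half_series_summable(1) s]
  note EC = geo_series_expectation[of ?a ?b' w s ?c, OF seq_bounds(1) seq_bounds(3) adm C half_series_summable(2) s]
  show "integrable (measure_pmf w) (\<lambda>x. half_series p h v z (jump s x))"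
    unfolding half_series_def using ED(1) EC(1) by (rule Bochner_Integration.integrable_add)
  have exp: "measure_pmf.expectation w (\<lambda>x. half_series p h v z (jump s x)) =
      measure_pmf.expectation w (\<lambda>x. ?SD (jump s x)) + measure_pmf.expectation w (\<lambda>x. ?SC (jump s x))"
    unfolding half_series_def using ED(1) EC(1) by (rule Bochner_Integration.integral_add)
  have sD: "(\<lambda>n. ?d n * of_real (geo (?a n) (?b n) s)) sums ?SD s"
    by (rule summable_sums[OF summable_norm_cancel[OF half_series_norm_summable(1)[OF s]]])
  have sC: "(\<lambda>n. ?c n * of_real (geo (?a n) (?b' n) s)) sums ?SC s"
    by (rule summable_sums[OF summable_norm_cancel[OF half_series_norm_summable(2)[OF s]]])
  have "(\<lambda>n. (?d n * of_real (geo (?a n) (?b n) s) - y * (?d n * of_real (geo (?a n) (?b n) s * weight_gf w (?a n) (?b n))))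
      + (?c n * of_real (geo (?a n) (?b' n) s) - y * (?c n * of_real (geo (?a n) (?b' n) s * weight_gf w (?a n) (?b' n)))))
     sums ((?SD s - y * measure_pmf.expectation w (\<lambda>x. ?SD (jump s x))) + (?SC s - y * measure_pmf.expectation w (\<lambda>x. ?SC (jump s x))))"
    by (intro sums_add sums_diff sums_mult sD sC ED(2) EC(2))
  then show "(\<lambda>n. ?d n * contact_factor w y (?a n) (?b n) * of_real (geo (?a n) (?b n) s)
          + ?c n * contact_factor w y (?a n) (?b' n) * of_real (geo (?a n) (?b' n) s))
      sums (half_series p h v z s - y * measure_pmf.expectation w (\<lambda>x. half_series p h v z (jump s x)))"
    unfolding exp by (simp add: half_series_def contact_factor_def algebra_simps)
qed

text \<open>All pairs lie on the curve, so with \<open>y = 1\<close> every contact factor is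
  0.\<close>

lemma half_series_interior:
  shows "integrable (measure_pmf p) (\<lambda>x. half_series p h v z (jump (Suc i, Suc j) x))"
    and "measure_pmf.expectation p (\<lambda>x. half_series p h v z (jump (Suc i, Suc j) x)) = half_series p h v z (Suc i, Suc j)"
proof -
  have one: "weight_gf p (a_seq p (Suc n)) (b_seq p n) = 1" "weight_gf p (a_seq p (Suc n)) (b_seq p (Suc n)) = 1" for n
    by (rule seq_root seq_root2)+
  note res = half_series_residual(1)[OF admissible_p, of i j]
    half_series_residual(2)[OF admissible_p, of i j 1]
  show "integrable (measure_pmf p) (\<lambda>x. half_series p h v z (jump (Suc i, Suc j) x))"
    by (rule res(1)) (simp_all add: one weight_gf_eq_1_integrable)
  have "(\<lambda>n. 0) sums (half_series p h v z (Suc i, Suc j) -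
      1 * measure_pmf.expectation p (\<lambda>x. half_series p h v z (jump (Suc i, Suc j) x)))"
    using res(2) by (simp add: one weight_gf_eq_1_integrable contact_factor_def)
  from sums_unique2[OF this sums_zero]
  show "measure_pmf.expectation p (\<lambda>x. half_series p h v z (jump (Suc i, Suc j) x)) = half_series p h v z (Suc i, Suc j)"
    by simp
qed

lemma half_series_quadrant:
  assumes supp: "\<And>k l. k < 0 \<or> l < 0 \<or> (k, l) = (0, 0) \<Longrightarrow> pmf w (k, l) = 0" and s: "s \<noteq> (0, 0)"
  shows "integrable (measure_pmf w) (\<lambda>x. half_series p h v z (jump s x))"
    and "(\<lambda>n. d_fwd p h v z n * contact_factor w z (a_seq p (Suc n)) (b_seq p n) * of_real (geo (a_seq p (Suc n)) (b_seq p n) s)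
          + c_fwd p h v z (Suc n) * contact_factor w z (a_seq p (Suc n)) (b_seq p (Suc n)) * of_real (geo (a_seq p (Suc n)) (b_seq p (Suc n)) s))
      sums (half_series p h v z s - z * measure_pmf.expectation w (\<lambda>x. half_series p h v z (jump s x)))"
proof -
  have *: "integrable (measure_pmf w) (monomial2 (a_seq p m) (b_seq p n))"
    "0 \<le> weight_gf w (a_seq p m) (b_seq p n)" "weight_gf w (a_seq p m) (b_seq p n) \<le> 1" for m n
    using seq_bounds[of m] seq_bounds[of n] quadrant_weight_bounds[OF supp, of "a_seq p m" 1 "b_seq p n"] by auto
  show "integrable (measure_pmf w) (\<lambda>x. half_series p h v z (jump s x))"
    by (rule half_series_residual(1)[OF admissible_quadrant[OF supp] s * *])
  show "(\<lambda>n. d_fwd p h v z n * contact_factor w z (a_seq p (Suc n)) (b_seq p n) * of_real (geo (a_seq p (Suc n)) (b_seq p n) s)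
          + c_fwd p h v z (Suc n) * contact_factor w z (a_seq p (Suc n)) (b_seq p (Suc n)) * of_real (geo (a_seq p (Suc n)) (b_seq p (Suc n)) s))
      sums (half_series p h v z s - z * measure_pmf.expectation w (\<lambda>x. half_series p h v z (jump s x)))"
    by (rule half_series_residual(2)[OF admissible_quadrant[OF supp] s * *])
qed

text \<open>With second coordinate 0 the two monomials of a pair coincide, and the recurrence for
  \<open>c_fwd\<close> is the cancellation of their coefficients.\<close>

lemma half_series_horizontal:
  shows "integrable (measure_pmf h) (\<lambda>x. half_series p h v z (jump (Suc i, 0) x))"
    and "z * measure_pmf.expectation h (\<lambda>x. half_series p h v z (jump (Suc i, 0) x)) = half_series p h v z (Suc i, 0)"
proof -
  show "integrable (measure_pmf h) (\<lambda>x. half_series p h v z (jump (Suc i, 0) x))"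
    by (rule half_series_quadrant(1)[OF h_supp]) simp_all
  have "d_fwd p h v z n * contact_factor h z (a_seq p (Suc n)) (b_seq p n)
      + c_fwd p h v z (Suc n) * contact_factor h z (a_seq p (Suc n)) (b_seq p (Suc n)) = 0" for n
    using contact_factor_nonzero(2)[OF z, of n] unfolding c_fwd_Suc by simp
  then have cancel: "d_fwd p h v z n * contact_factor h z (a_seq p (Suc n)) (b_seq p n) * t
      + c_fwd p h v z (Suc n) * contact_factor h z (a_seq p (Suc n)) (b_seq p (Suc n)) * t = 0" for n t
    by (metis distrib_right mult_zero_left)
  have "(\<lambda>n. 0) sums (half_series p h v z (Suc i, 0) -
      z * measure_pmf.expectation h (\<lambda>x. half_series p h v z (jump (Suc i, 0) x)))"
    using half_series_quadrant(2)[OF h_supp, of "(Suc i, 0)"] by (simp add: geo_def cancel)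
  from sums_unique2[OF this sums_zero]
  show "z * measure_pmf.expectation h (\<lambda>x. half_series p h v z (jump (Suc i, 0) x)) = half_series p h v z (Suc i, 0)"
    by simp
qed

text \<open>With first coordinate 0 the monomials with equal second base coincide, so each
  \<open>d_fwd\<close> term cancels the \<open>c_fwd\<close> term of the preceding pair. The first
  one has no partner and leaves \<open>g 0\<close>, the term of the constant monomial.\<close>

lemma half_series_vertical:
  shows "integrable (measure_pmf v) (\<lambda>x. half_series p h v z (jump (0, Suc j) x))"
    and "z * measure_pmf.expectation v (\<lambda>x. half_series p h v z (jump (0, Suc j) x)) = half_series p h v z (0, Suc j) + (1 - z)"
proof -
  show "integrable (measure_pmf v) (\<lambda>x. half_series p h v z (jump (0, Suc j) x))"
    by (rule half_series_quadrant(1)[OF v_supp]) simp_all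
  define g where "g n = c_fwd p h v z n * contact_factor v z (a_seq p n) (b_seq p n) * of_real (b_seq p n ^ Suc j)" for n
  have "d_fwd p h v z n * contact_factor v z (a_seq p (Suc n)) (b_seq p n) =
      - c_fwd p h v z n * contact_factor v z (a_seq p n) (b_seq p n)" for n
    using contact_factor_nonzero(1)[OF z, of n] by (simp add: d_fwd_def)
  then have tele: "(\<lambda>n. d_fwd p h v z n * contact_factor v z (a_seq p (Suc n)) (b_seq p n) * of_real (geo (a_seq p (Suc n)) (b_seq p n) (0, Suc j))
          + c_fwd p h v z (Suc n) * contact_factor v z (a_seq p (Suc n)) (b_seq p (Suc n)) * of_real (geo (a_seq p (Suc n)) (b_seq p (Suc n)) (0, Suc j)))
      = (\<lambda>n. g (Suc n) - g n)"
    by (simp add: fun_eq_iff geo_def g_def)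
  have "g \<longlonglongrightarrow> 0"
  \<comment> \<open>The bounds on the coefficients begin at index 1, hence the shift.\<close>
  proof (rule LIMSEQ_imp_Suc, rule Lim_null_comparison)
    have "summable (\<lambda>n. norm (c_fwd p h v z (Suc n)) * a_seq p (Suc n))"
      by (rule summable_c_fwd[OF z])
    then show "(\<lambda>n. 2 * (norm (c_fwd p h v z (Suc n)) * a_seq p (Suc n))) \<longlonglongrightarrow> 0"
      by (intro tendsto_mult_right_zero summable_LIMSEQ_zero)
    show "\<forall>\<^sub>F n in sequentially. norm (g (Suc n)) \<le> 2 * (norm (c_fwd p h v z (Suc n)) * a_seq p (Suc n))"
    proof (intro always_eventually allI)
      fix n
      let ?a = "a_seq p (Suc n)" and ?b = "b_seq p (Suc n)"
      have "norm (contact_factor v z ?a ?b) \<le> 1 + 1"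
        using v_gf_bounds(1,2)[of "Suc n"] seq_bounds(2)[of "Suc n"]
        by (intro contact_factor_bounds(1) z) auto
      moreover have "?b ^ Suc j \<le> ?b ^ 1"
        using seq_bounds[of "Suc n"] by (intro power_decreasing) auto
      then have "?b ^ Suc j \<le> ?a"
        using b_seq_le_a_seq[of "Suc n"] by simp
      ultimately have "norm (c_fwd p h v z (Suc n)) * norm (contact_factor v z ?a ?b) * ?b ^ Suc j
          \<le> norm (c_fwd p h v z (Suc n)) * (1 + 1) * ?a"
        using seq_bounds(3)[of "Suc n"] by (intro mult_mono mult_left_mono) auto
      then show "norm (g (Suc n)) \<le> 2 * (norm (c_fwd p h v z (Suc n)) * ?a)"
        using seq_bounds(3)[of "Suc n"] by (simp add: g_def norm_mult norm_power)
    qed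
  qed
  then have 1: "(\<lambda>n. g (Suc n) - g n) sums (0 - g 0)"
    by (rule telescope_sums)
  have 2: "(\<lambda>n. g (Suc n) - g n) sums (half_series p h v z (0, Suc j) -
      z * measure_pmf.expectation v (\<lambda>x. half_series p h v z (jump (0, Suc j) x)))"
    using half_series_quadrant(2)[OF v_supp, of "(0, Suc j)"] unfolding tele by simp
  have "g 0 = 1 - z"
    by (simp add: g_def contact_factor_def weight_gf_1_1)
  with sums_unique2[OF 2 1] show "z * measure_pmf.expectation v (\<lambda>x. half_series p h v z (jump (0, Suc j) x)) = half_series p h v z (0, Suc j) + (1 - z)"
    by (simp add: algebra_simps)
qed

end

end

section \<open>The full series and the Lyapunov function\<close>

lemma ab_bwd_swap: "ab_bwd p n = prod.swap (ab_fwd (swap_w p) n)"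
  by (induction n) (simp_all add: Let_def v_star_swap[of p] v_star_swap[of "swap_w p"])

lemma alpha_minus: "alpha p (- int n) = b_seq (swap_w p) n"
  and beta_minus: "beta p (- int n) = a_seq (swap_w p) n"
  by (cases "n = 0"; simp add: alpha_def beta_def a_seq_def b_seq_def ab_bwd_swap)+

lemma factor_minus:
  "factor p w z (- int m) (- int n) = contact_factor (swap_w w) z (a_seq (swap_w p) n) (b_seq (swap_w p) m)"
  by (simp add: factor_def contact_factor_def alpha_minus beta_minus weight_gf_swap)

text \<open>The backward recurrence uses first the horizontal and then the vertical factors, which
  is the forward one with \<open>h\<close> and \<open>v\<close> exchanged.\<close>

lemma c_bwd_swap: "c_bwd p h v z n = c_fwd (swap_w p) (swap_w v) (swap_w h) z n"
proof (induction n)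
  case (Suc n)
  have "- int n - 1 = - int (Suc n)"
    by simp
  then show ?case
    unfolding c_bwd.simps Let_def Suc c_fwd_Suc d_fwd_def
    by (simp only: factor_minus)
qed simp

lemma c_coeff_of_nat: "c_coeff p h v z (int n) = c_fwd p h v z n"
  by (simp add: c_coeff_def)

lemma c_coeff_minus: "c_coeff p h v z (- int n) = c_fwd (swap_w p) (swap_w v) (swap_w h) z n"
  by (cases "n = 0") (simp_all add: c_coeff_def c_bwd_swap)

lemma d_coeff_of_nat: "d_coeff p h v z (int (Suc n)) = d_fwd p h v z n"
proof -
  have "int (Suc n) - 1 = int n"
    by simp
  then show ?thesis
    unfolding d_coeff_def d_fwd_def
    by (simp only: factor_of_nat c_coeff_of_nat) simp
qed

lemma d_coeff_minus: "d_coeff p h v z (- int n) = d_fwd (swap_w p) (swap_w v) (swap_w h) z n"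
proof -
  have "- int n - 1 = - int (Suc n)"
    by simp
  then show ?thesis
    unfolding d_coeff_def d_fwd_def
    by (simp only: factor_minus c_coeff_minus) simp
qed

lemma G_term_of_nat:
  "G_term p h v i j z (int n) = c_fwd p h v z n * of_real (geo (a_seq p n) (b_seq p n) (i, j)) +
     d_fwd p h v z n * of_real (geo (a_seq p (Suc n)) (b_seq p n) (i, j))"
proof -
  have *: "int n + 1 = int (Suc n)"
    by simp
  show ?thesis
    unfolding G_term_def * d_coeff_of_nat c_coeff_of_nat alpha_of_nat beta_of_nat geo_def by simp
qed

lemma G_term_minus:
  fixes p h v :: weights
  defines "p' \<equiv> swap_w p" and "h' \<equiv> swap_w v" and "v' \<equiv> swap_w h"
  shows "G_term p h v i j z (- int (Suc n)) =
     c_fwd p' h' v' z (Suc n) * of_real (geo (a_seq p' (Suc n)) (b_seq p' (Suc n)) (j, i)) +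
     d_fwd p' h' v' z n * of_real (geo (a_seq p' (Suc n)) (b_seq p' n) (j, i))"
proof -
  have *: "- int (Suc n) + 1 = - int n"
    by simp
  show ?thesis
    unfolding G_term_def * d_coeff_minus c_coeff_minus alpha_minus beta_minus geo_def assms
    by (simp add: mult.commute)
qed

definition total_series :: "weights \<Rightarrow> weights \<Rightarrow> weights \<Rightarrow> complex \<Rightarrow> nat \<times> nat \<Rightarrow> complex" where
  "total_series p h v z s =
     1 + half_series p h v z s + half_series (swap_w p) (swap_w v) (swap_w h) z (prod.swap s)"

context singular_quadrant_data
begin

text \<open>\<open>G\<close> adds pairs over all integers, whereas the half series add the two
  families separately and shift one of them. Absolute convergence permits both regroupings.\<close>

lemma G_term_has_sum:
  assumes z: "norm z \<le> 1" and ij: "(i, j) \<noteq> (0, 0)"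
  shows "(G_term p h v i j z has_sum total_series p h v z (i, j)) UNIV"
proof -
  interpret sw: singular_quadrant_data "swap_w p" "swap_w v" "swap_w h" "swap_w q"
    by (rule swapped)
  let ?p = "swap_w p" and ?h = "swap_w v" and ?v = "swap_w h"
  let ?d = "\<lambda>n. d_fwd p h v z n * of_real (geo (a_seq p (Suc n)) (b_seq p n) (i, j))"
  let ?c = "\<lambda>n. c_fwd p h v z n * of_real (geo (a_seq p n) (b_seq p n) (i, j))"
  let ?d' = "\<lambda>n. d_fwd ?p ?h ?v z n * of_real (geo (a_seq ?p (Suc n)) (b_seq ?p n) (j, i))"
  let ?c' = "\<lambda>n. c_fwd ?p ?h ?v z (Suc n) * of_real (geo (a_seq ?p (Suc n)) (b_seq ?p (Suc n)) (j, i))"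
  have ji: "(j, i) \<noteq> (0, 0)"
    using ij by auto
  note S = half_series_norm_summable[OF z ij] and S' = sw.half_series_norm_summable[OF z ji]
  have Sc: "summable (\<lambda>n. norm (?c n))"
    by (rule iffD1[OF summable_Suc_iff S(2)])
  have c0: "?c 0 = 1"
    by (simp add: geo_def)
  have hc: "(?c has_sum (\<Sum>n. ?c n)) UNIV"
    by (rule norm_summable_imp_has_sum[OF Sc summable_sums[OF summable_norm_cancel[OF Sc]]])
  have hd: "(?d has_sum (\<Sum>n. ?d n)) UNIV"
    by (rule norm_summable_imp_has_sum[OF S(1) summable_sums[OF summable_norm_cancel[OF S(1)]]])
  have hc': "(?c' has_sum (\<Sum>n. ?c' n)) UNIV"
    by (rule norm_summable_imp_has_sum[OF S'(2) summable_sums[OF summable_norm_cancel[OF S'(2)]]])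
  have hd': "(?d' has_sum (\<Sum>n. ?d' n)) UNIV"
    by (rule norm_summable_imp_has_sum[OF S'(1) summable_sums[OF summable_norm_cancel[OF S'(1)]]])
  \<comment> \<open>The leading term is the constant 1 that the half series leaves out.\<close>
  have split: "(\<Sum>n. ?c n) = 1 + (\<Sum>n. ?c (Suc n))"
    using suminf_split_head[OF summable_norm_cancel[OF Sc]] unfolding c0 by simp
  have "((\<lambda>n. G_term p h v i j z (int n)) has_sum ((\<Sum>n. ?c n) + (\<Sum>n. ?d n))) UNIV"
    unfolding G_term_of_nat by (rule has_sum_add[OF hc hd])
  then have fwd: "(G_term p h v i j z has_sum (1 + half_series p h v z (i, j))) (range int)"
    by (subst has_sum_reindex) (simp_all add: o_def split half_series_def add_ac)
  have "((\<lambda>n. G_term p h v i j z (- int (Suc n))) has_sum ((\<Sum>n. ?c' n) + (\<Sum>n. ?d' n))) UNIV"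
    unfolding G_term_minus by (rule has_sum_add[OF hc' hd'])
  then have bwd: "(G_term p h v i j z has_sum half_series ?p ?h ?v z (j, i)) (range (\<lambda>n. - int (Suc n)))"
    by (subst has_sum_reindex) (simp_all add: o_def half_series_def add_ac inj_on_def)
  have "range int \<inter> range (\<lambda>n. - int (Suc n)) = {}"
    by auto
  moreover have "range int \<union> range (\<lambda>n. - int (Suc n)) = UNIV"
  proof -
    have "m \<in> range int \<union> range (\<lambda>n. - int (Suc n))" for m
      using int_cases[of m] by (metis UnI1 UnI2 rangeI)
    then show ?thesis by blast
  qed
  ultimately show ?thesis
    using has_sum_Un_disjoint[OF fwd bwd] by (simp add: total_series_def)
qed

lemma jump_swap: "jump (prod.swap s) (prod.swap x) = prod.swap (jump s x)"
  by (simp add: jump_def)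

lemma total_series_expectation:
  assumes int: "integrable (measure_pmf w) (\<lambda>x. half_series p h v z (jump s x))"
    and int': "integrable (measure_pmf (swap_w w)) (\<lambda>x. half_series (swap_w p) (swap_w v) (swap_w h) z (jump (prod.swap s) x))"
  shows "integrable (measure_pmf w) (\<lambda>x. total_series p h v z (jump s x))"
    and "measure_pmf.expectation w (\<lambda>x. total_series p h v z (jump s x)) =
      1 + measure_pmf.expectation w (\<lambda>x. half_series p h v z (jump s x)) +
      measure_pmf.expectation (swap_w w) (\<lambda>x. half_series (swap_w p) (swap_w v) (swap_w h) z (jump (prod.swap s) x))"
proof -
  let ?\<Psi> = "half_series (swap_w p) (swap_w v) (swap_w h) z"
  have int'': "integrable (measure_pmf w) (\<lambda>x. ?\<Psi> (prod.swap (jump s x)))"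
    using int' by (simp add: swap_w_def jump_swap)
  have exp: "measure_pmf.expectation (swap_w w) (\<lambda>x. ?\<Psi> (jump (prod.swap s) x)) =
      measure_pmf.expectation w (\<lambda>x. ?\<Psi> (prod.swap (jump s x)))"
    by (simp add: swap_w_def jump_swap)
  show "integrable (measure_pmf w) (\<lambda>x. total_series p h v z (jump s x))"
    unfolding total_series_def by (intro Bochner_Integration.integrable_add int int'') simp
  show "measure_pmf.expectation w (\<lambda>x. total_series p h v z (jump s x)) =
      1 + measure_pmf.expectation w (\<lambda>x. half_series p h v z (jump s x)) +
      measure_pmf.expectation (swap_w w) (\<lambda>x. ?\<Psi> (jump (prod.swap s) x))"
    unfolding exp total_series_def using int int'' by simp
qed

text \<open>The factor is charged at the state being left, so products along a path count the
  contacts before the current time.\<close>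

definition contact_weight :: "complex \<Rightarrow> nat \<times> nat \<Rightarrow> complex" where
  "contact_weight z s = (if fst s = 0 \<or> snd s = 0 then z else 1)"

lemma total_series_harmonic:
  assumes z: "norm z \<le> 1" and s: "s \<noteq> (0, 0)"
  shows "contact_weight z s * measure_pmf.expectation (step_law p h v q s) (\<lambda>x. total_series p h v z (jump s x))
    = total_series p h v z s"
proof -
  interpret sw: singular_quadrant_data "swap_w p" "swap_w v" "swap_w h" "swap_w q"
    by (rule swapped)
  consider i j where "s = (Suc i, Suc j)" | i where "s = (Suc i, 0)" | j where "s = (0, Suc j)"
    using s by (cases s; cases "fst s"; cases "snd s") auto
  then show ?thesis
  proof cases
    case (1 i j)
    then show ?thesis
      using total_series_expectation(2)[OF half_series_interior(1)[OF z, of i j]]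
        sw.half_series_interior[OF z, of j i] half_series_interior(2)[OF z, of i j]
      by (simp add: step_law_def contact_weight_def total_series_def[of p h v z "(Suc i, Suc j)"])
  next
    \<comment> \<open>The swapped half sees this state on its own vertical axis, so its residual
      cancels the \<open>1 - z\<close> of the constant.\<close>
    case (2 i)
    then show ?thesis
      using total_series_expectation(2)[OF half_series_horizontal(1)[OF z, of i]]
        sw.half_series_vertical[OF z, of i] half_series_horizontal(2)[OF z, of i]
      by (simp add: step_law_def contact_weight_def total_series_def[of p h v z "(Suc i, 0)"] distrib_left)
  next
    case (3 j)
    then show ?thesis
      using total_series_expectation(2)[OF half_series_vertical(1)[OF z, of j]]
        sw.half_series_horizontal[OF z, of j] half_series_vertical(2)[OF z, of j]
      by (simp add: step_law_def contact_weight_def total_series_def[of p h v z "(0, Suc j)"] distrib_left)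
  qed
qed

section \<open>Geometric decay along the walk\<close>

lemma admissible_step_law: "admissible (step_law p h v q s) s"
proof -
  have q_supp: "pmf q (k, l) = 0" if "k < 0 \<or> l < 0 \<or> (k, l) = (0, 0)" for k l
    using reflection_support[of q] that by simp
  show ?thesis
    using admissible_p[of "fst s - 1" "snd s - 1"] admissible_quadrant[OF h_supp]
      admissible_quadrant[OF v_supp] admissible_quadrant[OF q_supp]
    by (cases s) (auto simp: step_law_def)
qed

lemma between_roots:
  obtains a where "a_seq p 1 < a" "a < 1" "weight_gf p a 1 < 1"
proof -
  obtain a where a: "a_seq p 1 < a" "a < 1"
    using dense a_seq_Suc_less_1[of 0] by auto
  have "weight_gf p a 1 < 1"
    using weight_gf_around_root(1)[of "a_seq p 1" 1 a] a seq_bounds[of 1] a_seq_Suc_less_1[of 0] seq_root(2)[of 0]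
    by simp
  then show ?thesis
    using that a by blast
qed

text \<open>The drift is strict in the interior because \<open>a\<close> and \<open>b\<close> lie strictly between the two roots of
  the one-variable transforms, and on an axis because the reflection has a positive mean away from it.\<close>

lemma lyapunov:
  obtains a b r where "a_seq p 1 < a" "a < 1" "a_seq (swap_w p) 1 < b" "b < 1" "0 \<le> r" "r < 1"
    "\<And>s. s \<noteq> (0, 0) \<Longrightarrow>
      measure_pmf.expectation (step_law p h v q s) (\<lambda>x. geo a 1 (jump s x) + geo 1 b (jump s x))
        \<le> r * (geo a 1 s + geo 1 b s)"
proof -
  interpret sw: singular_quadrant_data "swap_w p" "swap_w v" "swap_w h" "swap_w q"
    by (rule swapped)
  obtain a where a: "a_seq p 1 < a" "a < 1" "weight_gf p a 1 < 1"
    by (rule between_roots)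
  obtain b where b: "a_seq (swap_w p) 1 < b" "b < 1" "weight_gf p 1 b < 1"
    by (rule sw.between_roots[unfolded weight_gf_swap])
  have pos: "0 < a" "0 < b"
    using a b seq_bounds(1)[of 1] sw.seq_bounds(1)[of 1] by auto
  define Hb where "Hb = weight_gf h 1 b"
  define Va where "Va = weight_gf v a 1"
  have Hb: "0 \<le> Hb" "Hb < 1"
    using quadrant_weight_bounds(2)[OF h_supp, of 1 1 b] sw.weight_gf_v_less_1[of b] pos b
    by (auto simp: Hb_def weight_gf_swap)
  have Va: "0 \<le> Va" "Va < 1"
    using quadrant_weight_bounds(2)[OF v_supp, of a 1 1] weight_gf_v_less_1[of a] pos a
    by (auto simp: Va_def)
  \<comment> \<open>Two rates belong to the interior and two to the axes. On an axis one monomial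
    equals 1 and shrinks by \<open>Hb\<close> or \<open>Va\<close>, while for the other only the
    absence of growth is used.\<close>
  define r where "r = Max {weight_gf p a 1, weight_gf p 1 b, (1 + Hb) / 2, (1 + Va) / 2}"
  have r: "weight_gf p a 1 \<le> r" "weight_gf p 1 b \<le> r" "(1 + Hb) / 2 \<le> r" "(1 + Va) / 2 \<le> r"
    unfolding r_def by (rule Max_ge; simp)+
  have r1: "r < 1"
    using a b Hb Va by (simp add: r_def)
  have r0: "0 \<le> r"
    using r(3) Hb by simp
  \<comment> \<open>\<open>(1 - y) / (1 + x) \<ge> (1 - y) / 2\<close> for \<open>x \<le> 1\<close>\<close>
  have axis: "x + y \<le> r * (x + 1)" if "0 \<le> x" "x \<le> 1" "y \<le> 1" "(1 + y) / 2 \<le> r" for x y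
  proof -
    have "x + y \<le> (1 + y) / 2 * (x + 1)"
      using mult_nonneg_nonneg[of "1 - y" "1 - x"] that by (simp add: field_simps)
    also have "\<dots> \<le> r * (x + 1)"
      using that by (intro mult_right_mono) auto
    finally show ?thesis .
  qed
  have split: "measure_pmf.expectation w (\<lambda>x. geo a 1 (jump s x) + geo 1 b (jump s x)) =
      geo a 1 s * weight_gf w a 1 + geo 1 b s * weight_gf w 1 b"
    if "admissible w s" "integrable (measure_pmf w) (monomial2 a 1)" "integrable (measure_pmf w) (monomial2 1 b)" for w s
    using geo_expectation[OF pos(1) zero_less_one that(1,2)] geo_expectation[OF zero_less_one pos(2) that(1,3)]
    by simp
  have geo1: "0 \<le> geo a 1 s" "geo a 1 s \<le> 1" "0 \<le> geo 1 b s" "geo 1 b s \<le> 1" for s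
    using pos a b by (auto simp: geo_def power_le_one)
  have "measure_pmf.expectation (step_law p h v q s) (\<lambda>x. geo a 1 (jump s x) + geo 1 b (jump s x))
      \<le> r * (geo a 1 s + geo 1 b s)" if s: "s \<noteq> (0, 0)" for s
  proof -
    consider "fst s > 0" "snd s > 0" | "fst s > 0" "snd s = 0" | "fst s = 0" "snd s > 0"
      using s by (cases s; cases "fst s"; cases "snd s") auto
    then show ?thesis
    proof cases
      case 1
      then have law: "step_law p h v q s = p"
        by (simp add: step_law_def case_prod_unfold)
      have conv: "p_conv a 1" "p_conv 1 b"
        using pos a b by (simp_all add: p_conv_le_1)
      have "geo a 1 s * weight_gf p a 1 + geo 1 b s * weight_gf p 1 b \<le> geo a 1 s * r + geo 1 b s * r"
        using r geo1 by (intro add_mono mult_left_mono) auto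
      then show ?thesis
        using split[OF _ conv, of s] admissible_step_law[of s] unfolding law by (simp add: algebra_simps)
    next
      case 2
      then have law: "step_law p h v q s = h"
        by (simp add: step_law_def case_prod_unfold)
      note bd = quadrant_weight_bounds[OF h_supp, of a 1 1] quadrant_weight_bounds[OF h_supp, of 1 1 b]
      have "geo 1 b s = 1"
        using 2 by (simp add: geo_def)
      moreover have "geo a 1 s * weight_gf h a 1 \<le> geo a 1 s * 1"
        using bd(3) pos a geo1 by (intro mult_left_mono) auto
      ultimately show ?thesis
        using split[of h s] bd(1,4) admissible_step_law[of s] axis[of "geo a 1 s" Hb] geo1 Hb r pos a b
        unfolding law by (simp add: Hb_def)
    next
      case 3
      then have law: "step_law p h v q s = v"
        by (simp add: step_law_def case_prod_unfold)
      note bd = quadrant_weight_bounds[OF v_supp, of a 1 1] quadrant_weight_bounds[OF v_supp, of 1 1 b]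
      have "geo a 1 s = 1"
        using 3 by (simp add: geo_def)
      moreover have "geo 1 b s * weight_gf v 1 b \<le> geo 1 b s * 1"
        using bd(6) pos b geo1 by (intro mult_left_mono) auto
      ultimately show ?thesis
        using split[of v s] bd(1,4) admissible_step_law[of s] axis[of "geo 1 b s" Va] geo1 Va r pos a b
        unfolding law by (simp add: Va_def add.commute)
    qed
  qed
  then show ?thesis
    using that[of a b r] a b r1 r0 by blast
qed

text \<open>The rates are the largest first bases of the two halves. They are smaller than the bases
  in \<open>lyapunov\<close>, so the function there dominates this bound.\<close>

lemma total_series_bound:
  assumes z: "norm z \<le> 1"
  obtains C where "0 \<le> C" "\<And>s. s \<noteq> (0, 0) \<Longrightarrow>
    norm (total_series p h v z s - 1) \<le> C * (geo (a_seq p 1) 1 s + geo 1 (a_seq (swap_w p) 1) s)"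
proof -
  interpret sw: singular_quadrant_data "swap_w p" "swap_w v" "swap_w h" "swap_w q"
    by (rule swapped)
  obtain C where C: "0 \<le> C" "\<And>s. s \<noteq> (0, 0) \<Longrightarrow> norm (half_series p h v z s) \<le> C * a_seq p 1 ^ fst s"
    using half_series_bound[OF z] by blast
  obtain C' where C': "0 \<le> C'" "\<And>s. s \<noteq> (0, 0) \<Longrightarrow>
      norm (half_series (swap_w p) (swap_w v) (swap_w h) z s) \<le> C' * a_seq (swap_w p) 1 ^ fst s"
    using sw.half_series_bound[OF z] by blast
  show ?thesis
  proof (rule that[of "C + C'"])
    fix s :: "nat \<times> nat"
    assume s: "s \<noteq> (0, 0)"
    then have s': "prod.swap s \<noteq> (0, 0)"
      by (cases s) auto
    have nonneg: "0 \<le> a_seq p 1 ^ fst s" "0 \<le> a_seq (swap_w p) 1 ^ snd s"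
      using seq_bounds(1)[of 1] sw.seq_bounds(1)[of 1] by (simp_all add: less_imp_le)
    have "norm (total_series p h v z s - 1) \<le>
        norm (half_series p h v z s) + norm (half_series (swap_w p) (swap_w v) (swap_w h) z (prod.swap s))"
      unfolding total_series_def by (simp add: norm_triangle_ineq)
    also have "\<dots> \<le> C * a_seq p 1 ^ fst s + C' * a_seq (swap_w p) 1 ^ snd s"
      using C(2)[OF s] C'(2)[OF s'] by (intro add_mono) simp_all
    also have "\<dots> \<le> (C + C') * a_seq p 1 ^ fst s + (C + C') * a_seq (swap_w p) 1 ^ snd s"
      using C(1) C'(1) nonneg by (intro add_mono mult_right_mono) auto
    finally show "norm (total_series p h v z s - 1) \<le>
        (C + C') * (geo (a_seq p 1) 1 s + geo 1 (a_seq (swap_w p) 1) s)"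
      by (simp add: geo_def distrib_left)
  qed (use C C' in simp)
qed

end

section \<open>Histories of the walk\<close>

lemma integral_bind_pmf_bounded:
  fixes f :: "'b \<Rightarrow> real"
  assumes "\<And>x. \<bar>f x\<bar> \<le> B"
  shows "measure_pmf.expectation (bind_pmf M N) f = measure_pmf.expectation M (\<lambda>x. measure_pmf.expectation (N x) f)"
  unfolding measure_pmf_bind
  by (rule integral_bind[where K = "count_space UNIV" and B = B and B' = 1])
    (use assms in \<open>auto simp: measure_pmf.emeasure_space_1 measure_pmf_in_subprob_algebra intro: measure_pmf.finite_measure_axioms\<close>)

lemma integrable_pmf_bounded:
  fixes f :: "'b \<Rightarrow> 'c :: {banach, second_countable_topology}"
  assumes "\<And>x. norm (f x) \<le> B"
  shows "integrable (measure_pmf M) f"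
  using assms by (intro measure_pmf.integrable_const_bound[where B = B]) auto

lemma norm_expectation_pmf_le:
  fixes f :: "'b \<Rightarrow> 'c :: {banach, second_countable_topology}"
  assumes "\<And>x. norm (f x) \<le> B"
  shows "norm (measure_pmf.expectation M f) \<le> B"
proof -
  have "norm (measure_pmf.expectation M f) \<le> measure_pmf.expectation M (\<lambda>x. norm (f x))"
    by (rule integral_norm_bound)
  also have "\<dots> \<le> B"
    using assms by (intro measure_pmf.integral_le_const integrable_pmf_bounded[where B = B]) auto
  finally show ?thesis .
qed

lemma complex_integral_bind_pmf_bounded:
  fixes f :: "'b \<Rightarrow> complex"
  assumes f: "\<And>x. norm (f x) \<le> B"
  shows "measure_pmf.expectation (bind_pmf M N) f = measure_pmf.expectation M (\<lambda>x. measure_pmf.expectation (N x) f)"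
proof (rule complex_eqI)
  note int = integrable_pmf_bounded[of f, OF f]
    integrable_pmf_bounded[of "\<lambda>x. measure_pmf.expectation (N x) f", OF norm_expectation_pmf_le[OF f]]
  have "\<bar>Re (f x)\<bar> \<le> B" "\<bar>Im (f x)\<bar> \<le> B" for x
    using f[of x] abs_Re_le_cmod[of "f x"] abs_Im_le_cmod[of "f x"] by linarith+
  note bind = integral_bind_pmf_bounded[of "\<lambda>x. Re (f x)", OF this(1)]
    integral_bind_pmf_bounded[of "\<lambda>x. Im (f x)", OF this(2)]
  show "Re (measure_pmf.expectation (bind_pmf M N) f) =
      Re (measure_pmf.expectation M (\<lambda>x. measure_pmf.expectation (N x) f))"
    using bind(1) by (simp add: int flip: integral_Re)
  show "Im (measure_pmf.expectation (bind_pmf M N) f) =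
      Im (measure_pmf.expectation M (\<lambda>x. measure_pmf.expectation (N x) f))"
    using bind(2) by (simp add: int flip: integral_Im)
qed

text \<open>Histories are listed with the most recent state first.\<close>

primrec path_pmf :: "('s \<Rightarrow> 's pmf) \<Rightarrow> 's \<Rightarrow> nat \<Rightarrow> 's list pmf" where
  "path_pmf K x 0 = return_pmf [x]"
| "path_pmf K x (Suc n) = bind_pmf (path_pmf K x n) (\<lambda>l. map_pmf (\<lambda>t. t # l) (K (hd l)))"

definition history :: "(nat \<Rightarrow> 'a \<Rightarrow> 's) \<Rightarrow> nat \<Rightarrow> 'a \<Rightarrow> 's list" where
  "history S n \<omega> = rev (map (\<lambda>k. S k \<omega>) [0..<Suc n])"

lemma history_Suc: "history S (Suc n) \<omega> = S (Suc n) \<omega> # history S n \<omega>"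
  by (simp add: history_def)

lemma history_0: "history S 0 \<omega> = [S 0 \<omega>]"
  by (simp add: history_def)

lemma hd_history: "hd (history S n \<omega>) = S n \<omega>"
  by (simp add: history_def)

lemma history_eq_iff:
  assumes "length l = Suc n"
  shows "history S n \<omega> = l \<longleftrightarrow> (\<forall>k\<le>n. S k \<omega> = rev l ! k)"
proof -
  have "history S n \<omega> = l \<longleftrightarrow> map (\<lambda>k. S k \<omega>) [0..<Suc n] = rev l"
    unfolding history_def by (metis rev_rev_ident)
  also have "\<dots> \<longleftrightarrow> (\<forall>k<Suc n. S k \<omega> = rev l ! k)"
    using assms by (auto simp: list_eq_iff_nth_eq simp del: upt_Suc)
  finally show ?thesis
    by (simp add: less_Suc_eq_le)
qed

lemma length_history: "length (history S n \<omega>) = Suc n"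
  by (simp add: history_def)

lemma pmf_path_Suc: "pmf (path_pmf K x (Suc n)) (t # l) = pmf (path_pmf K x n) l * pmf (K (hd l)) t"
proof -
  have "pmf (map_pmf (\<lambda>t. t # l') (K (hd l'))) (t # l) = indicator {l} l' * pmf (K (hd l)) t" for l'
  proof (cases "l' = l")
    case True
    have "inj (\<lambda>t. t # l)" by (auto simp: inj_def)
    from pmf_map_inj'[OF this] show ?thesis
      by (simp add: True)
  next
    case False
    then have "t # l \<notin> set_pmf (map_pmf (\<lambda>t. t # l') (K (hd l')))"
      by auto
    then show ?thesis
      using False by (simp add: pmf_eq_0_set_pmf)
  qed
  then show ?thesis
    by (simp add: pmf_bind measure_pmf_single)
qed

lemma Nil_notin_path: "pmf (path_pmf K x n) [] = 0"
  by (cases n) (auto simp: pmf_eq_0_set_pmf)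

lemma path_expectation_Suc:
  fixes f :: "'s list \<Rightarrow> real"
  assumes "\<And>l. \<bar>f l\<bar> \<le> B"
  shows "measure_pmf.expectation (path_pmf K x (Suc n)) f =
    measure_pmf.expectation (path_pmf K x n) (\<lambda>l. measure_pmf.expectation (K (hd l)) (\<lambda>t. f (t # l)))"
  using assms by (simp add: integral_bind_pmf_bounded[where B = B])

lemma complex_path_expectation_Suc:
  fixes f :: "'s list \<Rightarrow> complex"
  assumes "\<And>l. norm (f l) \<le> B"
  shows "measure_pmf.expectation (path_pmf K x (Suc n)) f =
    measure_pmf.expectation (path_pmf K x n) (\<lambda>l. measure_pmf.expectation (K (hd l)) (\<lambda>t. f (t # l)))"
  using assms by (simp add: complex_integral_bind_pmf_bounded[where B = B])

lemma (in prob_space) count_space_distr_eq_pmf: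
  fixes X :: "'a \<Rightarrow> 's :: countable"
  assumes X: "X \<in> measurable M (count_space UNIV)"
    and eq: "\<And>l. prob {\<omega> \<in> space M. X \<omega> = l} = pmf w l"
  shows "distr M (count_space UNIV) X = measure_pmf w"
proof (rule measure_eqI_countable[where A = UNIV])
  fix l :: 's
  have "emeasure (distr M (count_space UNIV) X) {l} = emeasure M {\<omega> \<in> space M. X \<omega> = l}"
    by (subst emeasure_distr[OF X]) (auto simp: vimage_def Int_def intro!: arg_cong2[where f = emeasure])
  then show "emeasure (distr M (count_space UNIV) X) {l} = emeasure (measure_pmf w) {l}"
    by (simp add: emeasure_eq_measure eq emeasure_pmf_single)
qed auto

definition step_kernel :: "weights \<Rightarrow> weights \<Rightarrow> weights \<Rightarrow> weights \<Rightarrow> nat \<times> nat \<Rightarrow> (nat \<times> nat) pmf" where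
  "step_kernel p h v q s = map_pmf (jump s) (step_law p h v q s)"

context singular_quadrant_data
begin

text \<open>\<open>jump s\<close> is injective on the support of an admissible law, so a target has
  the weight of a single step.\<close>

lemma pmf_step_kernel: "pmf (step_kernel p h v q s) t = transition_prob p h v q s t"
proof -
  let ?w = "step_law p h v q s" and ?y = "(int (fst t) - int (fst s), int (snd t) - int (snd s))"
  have "x = ?y" if "x \<in> set_pmf ?w" "jump s x = t" for x
    using that admissible_step_law[of s] by (cases x) (force simp: admissible_def jump_def)
  moreover have "jump s ?y = t"
    by (simp add: jump_def)
  ultimately have "jump s -` {t} \<inter> set_pmf ?w = {?y} \<inter> set_pmf ?w"
    by auto
  then have "measure (measure_pmf ?w) (jump s -` {t}) = measure (measure_pmf ?w) {?y}"
    by (metis measure_Int_set_pmf)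
  then show ?thesis
    by (simp add: step_kernel_def pmf_map transition_prob_def measure_pmf_single)
qed

lemma step_kernel_nonzero: "(0, 0) \<notin> set_pmf (step_kernel p h v q s)"
  using admissible_step_law[of s] by (auto simp: step_kernel_def admissible_def)

lemma path_hd_nonzero:
  assumes "x \<noteq> (0, 0)" "l \<in> set_pmf (path_pmf (step_kernel p h v q) x n)"
  shows "hd l \<noteq> (0, 0)"
  using assms by (cases n) (auto simp: step_kernel_nonzero)

end

text \<open>Starting away from the origin, the walk never reaches it, so equations that hold off the
  origin can be iterated.\<close>

locale reflected_walk_process = singular_quadrant_data +
  fixes M :: "'a measure" and x :: "nat \<times> nat" and S :: "nat \<Rightarrow> 'a \<Rightarrow> nat \<times> nat"
  assumes walk: "reflected_walk p h v q M x S"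
    and x_nonzero: "x \<noteq> (0, 0)"
begin

sublocale prob_space M
  using walk by (simp add: reflected_walk_def)

lemma S_measurable [measurable]: "S n \<in> measurable M (count_space UNIV)"
  using walk by (simp add: reflected_walk_def)

abbreviation K :: "nat \<times> nat \<Rightarrow> (nat \<times> nat) pmf" where
  "K \<equiv> step_kernel p h v q"

lemma history_measurable [measurable]: "history S n \<in> measurable M (count_space UNIV)"
proof (induction n)
  case 0
  have "(\<lambda>\<omega>. [S 0 \<omega>]) \<in> measurable M (count_space UNIV)"
    by (rule measurable_compose[OF S_measurable]) simp
  then show ?case
    by (simp add: history_0[abs_def])
next
  case (Suc n)
  have "(\<lambda>\<omega>. S (Suc n) \<omega> # history S n \<omega>) \<in> measurable M (count_space UNIV)"
    by (rule measurable_compose_countable[OF _ S_measurable])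
      (rule measurable_compose[OF Suc], simp)
  then show ?case
    by (simp add: history_Suc[abs_def])
qed

lemma prob_history: "prob {\<omega> \<in> space M. history S n \<omega> = l} = pmf (path_pmf K x n) l"
proof (induction n arbitrary: l)
  case 0
  have AE: "AE \<omega> in M. S 0 \<omega> = x"
    using walk by (simp add: reflected_walk_def)
  show ?case
  proof (cases "l = [x]")
    case True
    have "AE \<omega> in M. history S 0 \<omega> = l"
      using AE by (simp add: history_0 True)
    then have "prob {\<omega> \<in> space M. history S 0 \<omega> = l} = 1"
      by (subst prob_Collect_eq_1) auto
    then show ?thesis
      by (simp add: True)
  next
    case False
    have "AE \<omega> in M. \<not> history S 0 \<omega> = l"
      using AE False by (auto simp: history_0)
    then have "prob {\<omega> \<in> space M. history S 0 \<omega> = l} = 0"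
      by (rule prob_eq_0_AE)
    then show ?thesis
      using False by simp
  qed
next
  case (Suc n)
  show ?case
  proof (cases l)
    case Nil
    then show ?thesis
      by (simp add: history_Suc Nil_notin_path del: path_pmf.simps)
  next
    case (Cons t l')
    show ?thesis
    proof (cases "length l' = Suc n")
      case True
      \<comment> \<open>\<open>reflected_walk\<close> speaks of infinite trajectories.
        \<open>rev l\<close> puts the list into time order, and only its entries up to
        \<open>Suc n\<close> are inspected.\<close>
      let ?s = "\<lambda>k. rev l ! k"
      have "l' \<noteq> []"
        using True by auto
      then have last: "?s (Suc n) = t" "?s n = hd l'" and init: "\<And>k. k \<le> n \<Longrightarrow> ?s k = rev l' ! k"
        using \<open>length l' = Suc n\<close> by (auto simp: Cons nth_append rev_nth hd_conv_nth)
      have "prob {\<omega> \<in> space M. history S (Suc n) \<omega> = l} = prob {\<omega> \<in> space M. \<forall>k\<le>Suc n. S k \<omega> = ?s k}"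
        using True by (subst history_eq_iff) (simp_all add: Cons)
      also have "\<dots> = prob {\<omega> \<in> space M. \<forall>k\<le>n. S k \<omega> = ?s k} * transition_prob p h v q (?s n) (?s (Suc n))"
        using walk unfolding reflected_walk_def by blast
      also have "{\<omega> \<in> space M. \<forall>k\<le>n. S k \<omega> = ?s k} = {\<omega> \<in> space M. history S n \<omega> = l'}"
        using True init by (simp add: history_eq_iff)
      finally show ?thesis
        unfolding last Suc by (simp add: Cons pmf_step_kernel pmf_path_Suc del: path_pmf.simps)
    next
      \<comment> \<open>A tail of the wrong length is never a history, so by the induction
        hypothesis both sides vanish.\<close>
      case False
      then have neq: "history S n \<omega> \<noteq> l'" for \<omega>
        using length_history[of S n \<omega>] by auto
      have "pmf (path_pmf K x n) l' = 0"
        using Suc[of l'] by (simp add: neq)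
      then show ?thesis
        by (simp add: Cons history_Suc neq pmf_path_Suc del: path_pmf.simps)
    qed
  qed
qed

lemma distr_history: "distr M (count_space UNIV) (history S n) = measure_pmf (path_pmf K x n)"
  by (rule count_space_distr_eq_pmf[OF history_measurable prob_history])

lemma expectation_history:
  fixes f :: "(nat \<times> nat) list \<Rightarrow> 'c :: {banach, second_countable_topology}"
  shows "expectation (\<lambda>\<omega>. f (history S n \<omega>)) = measure_pmf.expectation (path_pmf K x n) f"
  unfolding distr_history[symmetric] by (rule integral_distr[symmetric]) auto

lemma expectation_lyapunov:
  fixes f :: "nat \<times> nat \<Rightarrow> real"
  assumes f: "\<And>s. 0 \<le> f s" "\<And>s. f s \<le> B" and r: "0 \<le> r"
    and drift: "\<And>s. s \<noteq> (0, 0) \<Longrightarrow> measure_pmf.expectation (K s) f \<le> r * f s"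
  shows "expectation (\<lambda>\<omega>. f (S n \<omega>)) \<le> r ^ n * f x"
proof -
  have bound: "\<bar>f s\<bar> \<le> B" for s
    using f by simp
  have "measure_pmf.expectation (path_pmf K x n) (\<lambda>l. f (hd l)) \<le> r ^ n * f x"
  proof (induction n)
    case (Suc n)
    have "measure_pmf.expectation (path_pmf K x (Suc n)) (\<lambda>l. f (hd l)) =
        measure_pmf.expectation (path_pmf K x n) (\<lambda>l. measure_pmf.expectation (K (hd l)) f)"
      by (subst path_expectation_Suc[where B = B]) (simp_all add: bound)
    also have "\<dots> \<le> measure_pmf.expectation (path_pmf K x n) (\<lambda>l. r * f (hd l))"
    proof (rule integral_mono_AE)
      show "integrable (measure_pmf (path_pmf K x n)) (\<lambda>l. measure_pmf.expectation (K (hd l)) f)"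
        using norm_expectation_pmf_le[of f B] bound by (intro integrable_pmf_bounded[where B = B]) auto
      show "integrable (measure_pmf (path_pmf K x n)) (\<lambda>l. r * f (hd l))"
        using bound by (intro integrable_mult_right integrable_pmf_bounded[where B = B]) auto
      show "AE l in measure_pmf (path_pmf K x n). measure_pmf.expectation (K (hd l)) f \<le> r * f (hd l)"
        using drift path_hd_nonzero[OF x_nonzero] by (simp add: AE_measure_pmf_iff)
    qed
    also have "\<dots> = r * measure_pmf.expectation (path_pmf K x n) (\<lambda>l. f (hd l))"
      by simp
    also have "\<dots> \<le> r * (r ^ n * f x)"
      using Suc r by (rule mult_left_mono)
    finally show ?case
      by simp
  qed simp
  then show ?thesis
    using expectation_history[of "\<lambda>l. f (hd l)" n] by (simp add: hd_history)
qed

definition weight_list :: "complex \<Rightarrow> (nat \<times> nat) list \<Rightarrow> complex" where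
  "weight_list z l = prod_list (map (contact_weight z) l)"

lemma norm_weight_list:
  assumes "norm z \<le> 1"
  shows "norm (weight_list z l) \<le> 1"
proof (induction l)
  case (Cons s l)
  then show ?case
    using assms mult_mono[of "norm (contact_weight z s)" 1 "norm (weight_list z l)" 1]
    by (simp add: weight_list_def norm_mult contact_weight_def)
qed (simp add: weight_list_def)

text \<open>A step multiplies the weight by that of the current state, and the equation for
  \<open>g\<close> absorbs this factor. \<open>tl\<close> drops the current state because its weight
  is charged on leaving.\<close>

lemma expectation_harmonic:
  fixes g :: "nat \<times> nat \<Rightarrow> complex"
  assumes z: "norm z \<le> 1" and g: "\<And>s. norm (g s) \<le> B"
    and harm: "\<And>s. s \<noteq> (0, 0) \<Longrightarrow> contact_weight z s * measure_pmf.expectation (K s) g = g s"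
  shows "expectation (\<lambda>\<omega>. weight_list z (tl (history S n \<omega>)) * g (S n \<omega>)) = g x"
proof -
  let ?f = "\<lambda>l. weight_list z (tl l) * g (hd l)"
  have B: "0 \<le> B"
    using g[of undefined] norm_ge_zero order_trans by blast
  have bound: "norm (?f l) \<le> B" for l
    using mult_mono[OF norm_weight_list[OF z, of "tl l"] g[of "hd l"]] by (simp add: norm_mult)
  have "measure_pmf.expectation (path_pmf K x n) ?f = g x"
  proof (induction n)
    case (Suc n)
    have "measure_pmf.expectation (path_pmf K x (Suc n)) ?f =
        measure_pmf.expectation (path_pmf K x n) (\<lambda>l. weight_list z l * measure_pmf.expectation (K (hd l)) g)"
      by (subst complex_path_expectation_Suc[where B = B, OF bound]) simp
    also have "\<dots> = measure_pmf.expectation (path_pmf K x n) ?f"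
    proof (rule integral_cong_AE)
      have "weight_list z l * measure_pmf.expectation (K (hd l)) g = ?f l"
        if l: "l \<in> set_pmf (path_pmf K x n)" for l
      proof -
        have "l \<noteq> []"
          using l Nil_notin_path[of K x n] by (auto simp: set_pmf_iff)
        then have "weight_list z l = weight_list z (tl l) * contact_weight z (hd l)"
          by (cases l) (auto simp: weight_list_def)
        then show ?thesis
          using harm[OF path_hd_nonzero[OF x_nonzero l]] by (simp add: mult.assoc)
      qed
      then show "AE l in measure_pmf (path_pmf K x n).
          weight_list z l * measure_pmf.expectation (K (hd l)) g = ?f l"
        by (simp add: AE_measure_pmf_iff)
    qed auto
    finally show ?case
      using Suc by simp
  qed (simp add: weight_list_def)
  then show ?thesis
    using expectation_history[of ?f n] by (simp add: hd_history)
qed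

end

section \<open>The number of boundary contacts\<close>

context reflected_walk_process
begin

definition boundary :: "(nat \<times> nat) set" where
  "boundary = {s. fst s = 0 \<or> snd s = 0}"

definition contact_event :: "nat \<Rightarrow> 'a set" where
  "contact_event n = {\<omega> \<in> space M. boundary_contacts S \<omega> = of_nat n}"

lemma contact_event_sets [measurable]: "contact_event n \<in> sets M"
proof -
  have [measurable]: "(\<lambda>\<omega>. indicator A (S n \<omega>) :: ennreal) \<in> borel_measurable M" for n and A :: "(nat \<times> nat) set"
    by (rule measurable_compose[OF S_measurable]) simp
  have [measurable]: "boundary_contacts S \<in> borel_measurable M"
    unfolding boundary_contacts_def by measurable
  show ?thesis
    unfolding contact_event_def by measurable
qed

lemma boundary_contacts_finite:
  assumes "finite {k. S k \<omega> \<in> boundary}"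
  shows "boundary_contacts S \<omega> = of_nat (card {k. S k \<omega> \<in> boundary})"
proof -
  have "boundary_contacts S \<omega> = (\<Sum>n. indicator {k. S k \<omega> \<in> boundary} n)"
    unfolding boundary_contacts_def boundary_def by (intro suminf_cong) (simp add: indicator_def)
  also have "\<dots> = (\<Sum>n\<in>{k. S k \<omega> \<in> boundary}. indicator {k. S k \<omega> \<in> boundary} n)"
    by (rule suminf_finite[OF assms]) simp
  also have "\<dots> = of_nat (card {k. S k \<omega> \<in> boundary})"
    by simp
  finally show ?thesis .
qed

lemma weight_history:
  "weight_list z (tl (history S n \<omega>)) = z ^ card {k. k < n \<and> S k \<omega> \<in> boundary}"
proof -
  have "tl (history S n \<omega>) = rev (map (\<lambda>k. S k \<omega>) [0..<n])"
    by (simp add: history_def)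
  then have "weight_list z (tl (history S n \<omega>)) = prod_list (map (\<lambda>k. contact_weight z (S k \<omega>)) [0..<n])"
    by (simp add: weight_list_def rev_map[symmetric] o_def)
  also have "\<dots> = (\<Prod>k<n. contact_weight z (S k \<omega>))"
    by (subst prod.distinct_set_conv_list[symmetric]) (simp_all add: atLeast0LessThan)
  also have "\<dots> = (\<Prod>k<n. if S k \<omega> \<in> boundary then z else 1)"
    by (intro prod.cong) (simp_all add: contact_weight_def boundary_def)
  also have "\<dots> = (\<Prod>k\<in>{..<n} \<inter> {k. S k \<omega> \<in> boundary}. z)"
    by (subst prod.inter_restrict) simp_all
  also have "{..<n} \<inter> {k. S k \<omega> \<in> boundary} = {k. k < n \<and> S k \<omega> \<in> boundary}"
    by auto
  finally show ?thesis
    by simp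
qed

lemma weight_history_eventually:
  assumes "finite {k. S k \<omega> \<in> boundary}"
  shows "(\<lambda>n. weight_list z (tl (history S n \<omega>))) \<longlonglongrightarrow> z ^ card {k. S k \<omega> \<in> boundary}"
proof (rule tendsto_eventually)
  obtain N where N: "\<And>k. S k \<omega> \<in> boundary \<Longrightarrow> k < N"
    using assms by (metis (mono_tags, lifting) finite_nat_bounded lessThan_iff mem_Collect_eq subsetD)
  have "{k. k < n \<and> S k \<omega> \<in> boundary} = {k. S k \<omega> \<in> boundary}" if "n \<ge> N" for n
    using N that by force
  then show "\<forall>\<^sub>F n in sequentially. weight_list z (tl (history S n \<omega>)) = z ^ card {k. S k \<omega> \<in> boundary}"
    unfolding weight_history eventually_sequentially by metis
qed

text \<open>Series and limit both equal the expectation of \<open>z\<close> to the number of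
  contacts: one splits it by that number, the other is dominated convergence over growing time
  horizons. The finite total mass of the disjoint contact events covers the unit circle as
  well.\<close>

lemma contact_gf_sums:
  assumes z: "norm z \<le> 1" and fin: "AE \<omega> in M. finite {k. S k \<omega> \<in> boundary}"
    and lim: "(\<lambda>n. expectation (\<lambda>\<omega>. weight_list z (tl (history S n \<omega>)))) \<longlonglongrightarrow> L"
  shows "(\<lambda>n. of_real (measure M {\<omega> \<in> space M. boundary_contacts S \<omega> = of_nat n}) * z ^ n) sums L"
proof -
  let ?f = "\<lambda>n \<omega>. of_real (indicator (contact_event n) \<omega>) * z ^ n :: complex"
  have intf: "integrable M (?f n)" for n
    by (intro integrable_mult_left integrable_of_real integrable_real_indicator)
      (auto simp: less_top[symmetric])
  have single: "?f n \<omega> = (if n = card {k. S k \<omega> \<in> boundary} then z ^ n else 0)"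
    if "finite {k. S k \<omega> \<in> boundary}" "\<omega> \<in> space M" for n \<omega>
    using boundary_contacts_finite[OF that(1)] that(2) by (auto simp: contact_event_def indicator_def)
  have AE: "AE \<omega> in M. summable (\<lambda>n. norm (?f n \<omega>))"
    using fin AE_space
  proof eventually_elim
    fix \<omega>
    assume *: "finite {k. S k \<omega> \<in> boundary}" "\<omega> \<in> space M"
    show "summable (\<lambda>n. norm (?f n \<omega>))"
      by (rule summable_finite[of "{card {k. S k \<omega> \<in> boundary}}"]) (simp_all add: single[OF *])
  qed
  have disj: "disjoint_family contact_event"
    by (auto simp: disjoint_family_on_def contact_event_def)
  have norm: "expectation (\<lambda>\<omega>. norm (?f n \<omega>)) = measure M (contact_event n) * norm z ^ n" for n
    by (simp add: norm_mult norm_power)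
  have sum: "summable (\<lambda>n. expectation (\<lambda>\<omega>. norm (?f n \<omega>)))"
    unfolding norm
  proof (rule summable_comparison_test'[OF sums_summable[OF finite_measure_UNION[OF _ disj]]])
    show "norm (measure M (contact_event n) * norm z ^ n) \<le> measure M (contact_event n)" for n
      using z by (simp add: mult_left_le power_le_one)
  qed auto
  have "(\<lambda>n. expectation (?f n)) sums expectation (\<lambda>\<omega>. \<Sum>n. ?f n \<omega>)"
    by (rule sums_integral[OF intf AE sum])
  moreover have "expectation (?f n) = of_real (measure M (contact_event n)) * z ^ n" for n
    by simp
  moreover have "expectation (\<lambda>\<omega>. \<Sum>n. ?f n \<omega>) = L"
  proof (rule LIMSEQ_unique[OF _ lim])
    have meas: "(\<lambda>\<omega>. weight_list z (tl (history S n \<omega>))) \<in> borel_measurable M" for n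
      by (rule measurable_compose[OF history_measurable]) simp
    show "(\<lambda>n. expectation (\<lambda>\<omega>. weight_list z (tl (history S n \<omega>)))) \<longlonglongrightarrow> expectation (\<lambda>\<omega>. \<Sum>n. ?f n \<omega>)"
    proof (rule integral_dominated_convergence[where w = "\<lambda>_. 1"])
      show "AE \<omega> in M. (\<lambda>n. weight_list z (tl (history S n \<omega>))) \<longlonglongrightarrow> (\<Sum>n. ?f n \<omega>)"
        using fin AE_space
      proof eventually_elim
        fix \<omega>
        assume *: "finite {k. S k \<omega> \<in> boundary}" "\<omega> \<in> space M"
        have "(\<Sum>n. ?f n \<omega>) = z ^ card {k. S k \<omega> \<in> boundary}"
          by (subst suminf_finite[of "{card {k. S k \<omega> \<in> boundary}}"]) (simp_all add: single[OF *])
        then show "(\<lambda>n. weight_list z (tl (history S n \<omega>))) \<longlonglongrightarrow> (\<Sum>n. ?f n \<omega>)"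
          using weight_history_eventually[OF *(1)] by simp
      qed
      show "(\<lambda>\<omega>. \<Sum>n. ?f n \<omega>) \<in> borel_measurable M"
        by (rule borel_measurable_integrable[OF integrable_suminf[OF intf AE sum]])
    qed (use meas norm_weight_list[OF z] in auto)
  qed
  ultimately show ?thesis
    by (simp only: contact_event_def)
qed

lemma contact_gf_sums_total_series:
  assumes z: "norm z \<le> 1"
  shows "(\<lambda>n. of_real (measure M {\<omega> \<in> space M. boundary_contacts S \<omega> = of_nat n}) * z ^ n)
    sums total_series p h v z x"
proof -
  interpret sw: singular_quadrant_data "swap_w p" "swap_w v" "swap_w h" "swap_w q"
    by (rule swapped)
  obtain a b r where ab: "a_seq p 1 < a" "a < 1" "a_seq (swap_w p) 1 < b" "b < 1" and r: "0 \<le> r" "r < 1"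
    and drift: "\<And>s. s \<noteq> (0, 0) \<Longrightarrow>
      measure_pmf.expectation (step_law p h v q s) (\<lambda>x. geo a 1 (jump s x) + geo 1 b (jump s x))
        \<le> r * (geo a 1 s + geo 1 b s)"
    using lyapunov by blast
  define W where "W s = geo a 1 s + geo 1 b s" for s
  have pos: "0 < a_seq p 1" "0 < a_seq (swap_w p) 1"
    by (rule seq_bounds sw.seq_bounds)+
  then have geo: "0 \<le> geo a 1 s" "geo a 1 s \<le> 1" "0 \<le> geo 1 b s" "geo 1 b s \<le> 1" for s
    using ab by (auto simp: geo_def power_le_one)
  then have W: "0 \<le> W s" "W s \<le> 2" for s
    unfolding W_def using add_mono[of "geo a 1 s" 1 "geo 1 b s" 1] by auto
  \<comment> \<open>On the boundary one exponent is 0, so one of the two monomials is 1. Thus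
    \<open>W\<close> bounds the indicator of the boundary, and \<open>EW\<close> bounds the contact
    probabilities.\<close>
  have W_boundary: "1 \<le> W s" if "s \<in> boundary" for s
    using that geo[of s] by (auto simp: W_def boundary_def geo_def)
  have EW: "expectation (\<lambda>\<omega>. W (S n \<omega>)) \<le> r ^ n * W x" for n
    by (rule expectation_lyapunov[where B = 2, OF W r(1)]) (simp add: step_kernel_def drift W_def)
  have W_int: "integrable M (\<lambda>\<omega>. W (S n \<omega>))" for n
    using W by (intro integrable_const_bound[where B = 2] measurable_compose[OF S_measurable]) auto
  have summ: "summable (\<lambda>n. r ^ n * W x)"
    using r by (intro summable_mult2 summable_geometric) simp
  have fin: "AE \<omega> in M. finite {k. S k \<omega> \<in> boundary}"
  proof -
    let ?A = "\<lambda>n. {\<omega> \<in> space M. S n \<omega> \<in> boundary}"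
    have sets: "?A n \<in> sets M" for n
      using measurable_sets[OF S_measurable[of n], of boundary] by (simp add: vimage_def Int_def conj_commute)
    have le: "measure M (?A n) \<le> r ^ n * W x" for n
    proof -
      have "measure M (?A n) = expectation (indicator (?A n))"
        using sets by simp
      also have "\<dots> \<le> expectation (\<lambda>\<omega>. W (S n \<omega>))"
        using sets W W_boundary W_int
        by (intro integral_mono integrable_real_indicator) (auto simp: indicator_def less_top[symmetric])
      finally show ?thesis
        using EW[of n] by simp
    qed
    have "AE \<omega> in M. \<forall>\<^sub>F n in sequentially. \<omega> \<in> space M - ?A n"
      by (rule borel_cantelli_AE1[OF sets])
        (auto simp: less_top[symmetric] intro!: summable_comparison_test'[OF summ] le)
    then show ?thesis
    proof (rule AE_mp, intro AE_I2 impI)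
      fix \<omega>
      assume \<omega>: "\<omega> \<in> space M" and "\<forall>\<^sub>F n in sequentially. \<omega> \<in> space M - ?A n"
      then obtain N where "\<And>n. n \<ge> N \<Longrightarrow> S n \<omega> \<notin> boundary"
        unfolding eventually_sequentially by blast
      then have "{k. S k \<omega> \<in> boundary} \<subseteq> {..<N}"
        by (auto simp: not_le[symmetric])
      then show "finite {k. S k \<omega> \<in> boundary}"
        by (rule finite_subset) simp
    qed
  qed
  obtain C where C: "0 \<le> C" "\<And>s. s \<noteq> (0, 0) \<Longrightarrow>
      norm (total_series p h v z s - 1) \<le> C * (geo (a_seq p 1) 1 s + geo 1 (a_seq (swap_w p) 1) s)"
    using total_series_bound[OF z] by blast
  \<comment> \<open>the origin is never reached, so the value there is arbitrary\<close>
  define g where "g s = (if s = (0, 0) then 1 else total_series p h v z s)" for s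
  have g1: "norm (g s - 1) \<le> C * W s" for s
  proof (cases "s = (0, 0)")
    case True
    then show ?thesis
      using C(1) W by (simp add: g_def)
  next
    case False
    have "geo (a_seq p 1) 1 s + geo 1 (a_seq (swap_w p) 1) s \<le> W s"
      using pos ab unfolding W_def geo_def by (intro add_mono mult_mono power_mono) auto
    then have "C * (geo (a_seq p 1) 1 s + geo 1 (a_seq (swap_w p) 1) s) \<le> C * W s"
      using C(1) by (rule mult_left_mono)
    then show ?thesis
      using C(2)[OF False] False by (simp add: g_def)
  qed
  have g: "norm (g s) \<le> 1 + C * 2" for s
  proof -
    have "norm (g s) \<le> norm (g s - 1) + norm (1 :: complex)"
      using norm_triangle_ineq[of "g s - 1" 1] by simp
    also have "\<dots> \<le> C * 2 + 1"
      using g1[of s] mult_left_mono[OF W(2)[of s] C(1)] by simp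
    finally show ?thesis by simp
  qed
  have harm: "contact_weight z s * measure_pmf.expectation (K s) g = g s" if s: "s \<noteq> (0, 0)" for s
  proof -
    have "measure_pmf.expectation (K s) g = measure_pmf.expectation (step_law p h v q s) (\<lambda>x. total_series p h v z (jump s x))"
      unfolding step_kernel_def integral_map_pmf
      using admissible_step_law[of s]
      by (intro integral_cong_AE) (auto simp: AE_measure_pmf_iff g_def admissible_def)
    then show ?thesis
      using total_series_harmonic[OF z s] s by (simp add: g_def)
  qed
  let ?X = "\<lambda>n \<omega>. weight_list z (tl (history S n \<omega>))"
  have X_int: "integrable M (?X n)" for n
    using norm_weight_list[OF z]
    by (intro integrable_const_bound[where B = 1] measurable_compose[OF history_measurable]) auto
  have gS_int: "integrable M (\<lambda>\<omega>. ?X n \<omega> * g (S n \<omega>))" for n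
  proof (rule integrable_const_bound[where B = "1 * (1 + C * 2)"])
    show "AE \<omega> in M. norm (?X n \<omega> * g (S n \<omega>)) \<le> 1 * (1 + C * 2)"
      unfolding norm_mult using norm_weight_list[OF z] g by (intro AE_I2 mult_mono) auto
    show "(\<lambda>\<omega>. ?X n \<omega> * g (S n \<omega>)) \<in> borel_measurable M"
      by (intro borel_measurable_times measurable_compose[OF history_measurable] measurable_compose[OF S_measurable]) auto
  qed
  have Eg: "expectation (\<lambda>\<omega>. ?X n \<omega> * g (S n \<omega>)) = g x" for n
    by (rule expectation_harmonic[OF z g harm])
  \<comment> \<open>The weight has norm at most 1, so replacing \<open>g (S n \<omega>)\<close> by 1
    costs at most the expectation of \<open>C * W (S n \<omega>)\<close>.\<close>
  have close: "norm (expectation (?X n) - g x) \<le> C * (r ^ n * W x)" for n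
  proof -
    have "expectation (?X n) - g x = expectation (\<lambda>\<omega>. ?X n \<omega> - ?X n \<omega> * g (S n \<omega>))"
      using X_int gS_int by (simp add: Eg)
    also have "norm \<dots> \<le> expectation (\<lambda>\<omega>. norm (?X n \<omega> - ?X n \<omega> * g (S n \<omega>)))"
      by (rule integral_norm_bound)
    also have "\<dots> \<le> expectation (\<lambda>\<omega>. C * W (S n \<omega>))"
    proof (rule integral_mono)
      show "integrable M (\<lambda>\<omega>. norm (?X n \<omega> - ?X n \<omega> * g (S n \<omega>)))"
        using X_int gS_int by simp
      fix \<omega>
      have "norm (?X n \<omega> * (1 - g (S n \<omega>))) \<le> 1 * (C * W (S n \<omega>))"
        unfolding norm_mult using norm_weight_list[OF z] g1[of "S n \<omega>"]
        by (intro mult_mono) (auto simp: norm_minus_commute)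
      then show "norm (?X n \<omega> - ?X n \<omega> * g (S n \<omega>)) \<le> C * W (S n \<omega>)"
        by (simp add: algebra_simps)
    qed (use W_int in simp)
    also have "\<dots> \<le> C * (r ^ n * W x)"
      using EW[of n] C(1) by (simp add: mult_left_mono)
    finally show ?thesis .
  qed
  have "(\<lambda>n. expectation (?X n) - g x) \<longlonglongrightarrow> 0"
    by (rule Lim_null_comparison[OF always_eventually, of _ "\<lambda>n. C * (r ^ n * W x)"])
      (use close summable_LIMSEQ_zero[OF summ] in \<open>auto intro!: tendsto_mult_right_zero\<close>)
  then have "(\<lambda>n. expectation (?X n)) \<longlonglongrightarrow> g x"
    by (simp add: LIM_zero_iff)
  then show ?thesis
    using contact_gf_sums[OF z fin] x_nonzero by (simp add: g_def)
qed

end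

text \<open>Summability belongs to the conclusion because a divergent sum would give
  \<open>G\<close> the value 0.\<close>

theorem theorem5:
  fixes p h v q :: "(int \<times> int) pmf"
    and M :: "'a measure"
    and S :: "nat \<Rightarrow> 'a \<Rightarrow> nat \<times> nat"
    and i j :: nat
    and z :: complex
  assumes "singular_quadrant_data p h v q"
    and "(i, j) \<noteq> (0, 0)"
    and "reflected_walk p h v q M (i, j) S"
    and "norm z \<le> 1"
  shows "G_term p h v i j z summable_on UNIV \<and> contact_gf M S z = G p h v i j z"
proof -
  interpret reflected_walk_process p h v q M "(i, j)" S
    using assms by (simp add: reflected_walk_process_def reflected_walk_process_axioms_def)
  have "(G_term p h v i j z has_sum total_series p h v z (i, j)) UNIV"
    by (rule G_term_has_sum[OF assms(4,2)])
  moreover have "contact_gf M S z = total_series p h v z (i, j)"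
    unfolding contact_gf_def by (rule sums_unique[OF contact_gf_sums_total_series[OF assms(4)], symmetric])
  ultimately show ?thesis
    by (auto simp: G_def has_sum_imp_summable infsumI)
qed

end
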